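(* Let $\Omega\subsetneq\mathcal{X}$ be a complete Kobayashi hyperbolic domain of a complex manifold $\mathcal{X}$, with $\overline\Omega^{\mathrm{End}}$ sequentially compact, and suppose that $$\lim_{(z,w)\to(x,y)}\mathsf{k}_\Omega(z,w)=\infty\quad\text{for any } x\ne y\in\partial\Omega .$$ Let $p\in\Omega$ and let $f:\Omega\to\Omega$ be a holomorphic map such that the sequence of iterates $(f^n)_{n\ge1}$ is compactly divergent. Then there exist $x\in\partial\overline\Omega^{\mathrm{End}}$ and $\xi\in\mathscr{H}(x)$ such that, for every $n\in\mathbb{N}$, $$f^n(H_p(\xi,R))\subset H^b_p(x,R)\quad\text{for all } R>0.$$ In particular, for every $n\in\mathbb{N}$, we also have $$f^n(H^s_p(x,R))\subset H^b_p(x,R)\quad\text{for all } R>0.$$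
   Context: $\mathsf{k}_\Omega$ is the Kobayashi distance of $\Omega$; $\Omega$ is Kobayashi hyperbolic if $\mathsf{k}_\Omega$ is a genuine distance, and complete Kobayashi hyperbolic if moreover $(\Omega,\mathsf{k}_\Omega)$ is complete. A domain is a nonempty connected open set; $\overline\Omega$ and $\partial\Omega$ are the closure and boundary of $\Omega$ in $\mathcal{X}$. Limits $z\to x$, $(z,w)\to(x,y)$ are taken with $z,w\in\Omega$. $(f^n)$ is compactly divergent if for all compact $K,L\subset\Omega$ there is $n_0$ with $f^n(K)\cap L=\emptyset$ for all $n\ge n_0$. End compactification: let $(K_j)_{j\ge1}$ be an exhaustion of $\overline\Omega$ by compact sets with $K_j\subset\mathrm{int}(K_{j+1})$. An end is a sequence $(F_j)_{j\ge1}$ where $F_j$ is a connected component of $\overline\Omega\setminus K_j$ and $F_{j+1}\subset F_j$. With $\mathcal{E}$ the set of ends, $\overline\Omega^{\mathrm{End}}=\overline\Omega\sqcup\mathcal{E}$. A neighbourhood basis at $x\in\overline\Omega$ is given by the sets $U\cap\overline\Omega$, $U$ a neighbourhood of $x$ in $\mathcal{X}$; at an end $e=(F_j)$ it is given by $\widehat F_j=F_j\sqcup\{(G_\nu)\in\mathcal{E}: G_\nu=F_\nu,\ \nu=1,\dots,j\}$, $j\ge1$. This is a first-countable Hausdorff topology independent of the exhaustion. $\partial\overline\Omega^{\mathrm{End}}=\overline\Omega^{\mathrm{End}}\setminus\Omega$. Metric compactification of $(\Omega,\mathsf{k}_\Omega)$: let $C(\Omega)$ be the real-valued continuous functions on $\Omega$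 with the topology of local uniform convergence, $C_*(\Omega)$ its quotient by the constant functions with the quotient topology, and $i_{\mathsf{k}}:\Omega\to C_*(\Omega)$, $i_{\mathsf{k}}(x)=[\mathsf{k}_\Omega(x,\cdot)]$. Then $\overline\Omega^{\mathsf{k}}$ is the closure of $i_{\mathsf{k}}(\Omega)$ in $C_*(\Omega)$ and $\partial\overline\Omega^{\mathsf{k}}=\overline\Omega^{\mathsf{k}}\setminus i_{\mathsf{k}}(\Omega)$. For $\xi\in\partial\overline\Omega^{\mathsf{k}}$, $h_{p,\xi}$ is the unique function in the class $\xi$ with $h_{p,\xi}(p)=0$, and for $R>0$, $H_p(\xi,R)=\{z\in\Omega: h_{p,\xi}(z)<\frac12\log R\}$. For $x\in\partial\overline\Omega^{\mathrm{End}}$: $\mathscr{H}(x)=\{\xi\in\overline\Omega^{\mathsf{k}}\setminus i_{\mathsf{k}}(\Omega): \exists (x_n)\subset\Omega \text{ with } x_n\to x \text{ in } \overline\Omega^{\mathrm{End}} \text{ and } i_{\mathsf{k}}(x_n)\to\xi\}$, and for $R>0$, $H^b_p(x,R)=\{z\in\Omega:\liminf_{w\to x}(\mathsf{k}_\Omega(z,w)-\mathsf{k}_\Omega(p,w))<\frac12\log R\}$, $H^s_p(x,R)=\{z\in\Omega:\limsup_{w\to x}(\mathsf{k}_\Omega(z,w)-\mathsf{k}_\Omega(p,w))<\frac12\log R\}$. *)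

theory Defs
  imports "HOL-Analysis.Analysis"
begin

section \<open>Complex manifolds and holomorphic maps\<close>

text \<open>Frechet differentiability with a complex-linear derivative; used on open sets only.\<close>

definition cvec_holomorphic_on :: "(complex^'n \<Rightarrow> complex^'m) \<Rightarrow> (complex^'n) set \<Rightarrow> bool" where
  "cvec_holomorphic_on f S \<longleftrightarrow>
     (\<forall>z\<in>S. \<exists>D. (f has_derivative D) (at z) \<and> (\<forall>c v. D (c *s v) = c *s D v))"

type_synonym ('x, 'n) atlas = "('x set \<times> ('x \<Rightarrow> complex^'n)) set"

text \<open>The manifold is the whole type \<open>'x\<close>; Hausdorff and second countable are sort constraints.
  The atlas need not be maximal.  Dimension 0 is not covered by the index type \<open>'n\<close>, but there a
  domain is a single point and carries no compactly divergent self-map.\<close>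

definition complex_manifold ::
    "('x::{t2_space, second_countable_topology}, 'n::finite) atlas \<Rightarrow> bool" where
  "complex_manifold A \<longleftrightarrow>
     \<Union> (fst ` A) = UNIV \<and>
     (\<forall>(U, \<phi>)\<in>A. open U \<and> open (\<phi> ` U) \<and> homeomorphism U (\<phi> ` U) \<phi> (inv_into U \<phi>)) \<and>
     (\<forall>(U, \<phi>)\<in>A. \<forall>(V, \<psi>)\<in>A. cvec_holomorphic_on (\<psi> \<circ> inv_into U \<phi>) (\<phi> ` (U \<inter> V)))"

definition holomorphic_self_map :: "('x::topological_space, 'n::finite) atlas \<Rightarrow> 'x set \<Rightarrow> ('x \<Rightarrow> 'x) \<Rightarrow> bool" where
  "holomorphic_self_map A \<Omega> f \<longleftrightarrow>
     f ` \<Omega> \<subseteq> \<Omega> \<and> continuous_on \<Omega> f \<and>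
     (\<forall>(U, \<phi>)\<in>A. \<forall>(V, \<psi>)\<in>A.
        cvec_holomorphic_on (\<psi> \<circ> f \<circ> inv_into U \<phi>) (\<phi> ` (U \<inter> \<Omega> \<inter> f -` V)))"

definition holomorphic_disc :: "('x::topological_space, 'n::finite) atlas \<Rightarrow> 'x set \<Rightarrow> (complex \<Rightarrow> 'x) \<Rightarrow> bool" where
  "holomorphic_disc A \<Omega> g \<longleftrightarrow>
     g ` ball 0 1 \<subseteq> \<Omega> \<and> continuous_on (ball 0 1) g \<and>
     (\<forall>(U, \<phi>)\<in>A. \<forall>i. (\<lambda>\<zeta>. vec_nth (\<phi> (g \<zeta>)) i) holomorphic_on (ball 0 1 \<inter> g -` U))"


section \<open>Kobayashi distance\<close>

text \<open>Normalised to curvature \<open>-4\<close>, in accordance with the factor \<open>1/2\<close> in front of the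
  logarithm in the definition of horospheres.\<close>

definition poincare_dist :: "complex \<Rightarrow> complex \<Rightarrow> real" where
  "poincare_dist \<zeta> \<eta> = artanh (cmod ((\<zeta> - \<eta>) / (1 - cnj \<eta> * \<zeta>)))"

definition disc_chain ::
    "('x::topological_space, 'n::finite) atlas \<Rightarrow> 'x set \<Rightarrow> 'x \<Rightarrow> 'x \<Rightarrow> nat \<Rightarrow>
     (nat \<Rightarrow> complex \<Rightarrow> 'x) \<Rightarrow> (nat \<Rightarrow> complex) \<Rightarrow> (nat \<Rightarrow> complex) \<Rightarrow> bool" where
  "disc_chain A \<Omega> z w m g a b \<longleftrightarrow>
     (\<exists>c. c 0 = z \<and> c m = w \<and>
       (\<forall>i<m. holomorphic_disc A \<Omega> (g i) \<and> a i \<in> ball 0 1 \<and> b i \<in> ball 0 1 \<and>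
              g i (a i) = c i \<and> g i (b i) = c (Suc i)))"

text \<open>The value 0 off \<open>\<Omega>\<close> is a convention: \<^locale>\<open>Metric_space\<close> asks for nonnegativity and
  symmetry on the whole type.  For connected \<open>\<Omega>\<close> the infimum is over a nonempty set.\<close>

definition kobayashi :: "('x::topological_space, 'n::finite) atlas \<Rightarrow> 'x set \<Rightarrow> 'x \<Rightarrow> 'x \<Rightarrow> real" where
  "kobayashi A \<Omega> z w =
     (if z \<in> \<Omega> \<and> w \<in> \<Omega>
      then Inf {\<Sum>i<m. poincare_dist (a i) (b i) | m g a b. disc_chain A \<Omega> z w m g a b}
      else 0)"

definition kobayashi_hyperbolic :: "('x::topological_space, 'n::finite) atlas \<Rightarrow> 'x set \<Rightarrow> bool" where
  "kobayashi_hyperbolic A \<Omega> \<longleftrightarrow> Metric_space \<Omega> (kobayashi A \<Omega>)"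

definition complete_kobayashi_hyperbolic :: "('x::topological_space, 'n::finite) atlas \<Rightarrow> 'x set \<Rightarrow> bool" where
  "complete_kobayashi_hyperbolic A \<Omega> \<longleftrightarrow>
     kobayashi_hyperbolic A \<Omega> \<and> Metric_space.mcomplete \<Omega> (kobayashi A \<Omega>)"

definition compactly_divergent :: "'x::topological_space set \<Rightarrow> (nat \<Rightarrow> 'x \<Rightarrow> 'x) \<Rightarrow> bool" where
  "compactly_divergent \<Omega> F \<longleftrightarrow>
     (\<forall>K L. compact K \<and> K \<subseteq> \<Omega> \<and> compact L \<and> L \<subseteq> \<Omega> \<longrightarrow> (\<exists>n0. \<forall>n\<ge>n0. F n ` K \<inter> L = {}))"


section \<open>End compactification\<close>

text \<open>Exhaustions and ends are indexed from 0 instead of 1.\<close>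

definition compact_exhaustion :: "'x::topological_space set \<Rightarrow> (nat \<Rightarrow> 'x set) \<Rightarrow> bool" where
  "compact_exhaustion S K \<longleftrightarrow>
     (\<forall>j. compact (K j) \<and> K j \<subseteq> top_of_set S interior_of K (Suc j)) \<and> (\<Union>j. K j) = S"

definition ends :: "'x::topological_space set \<Rightarrow> (nat \<Rightarrow> 'x set) \<Rightarrow> (nat \<Rightarrow> 'x set) set" where
  "ends \<Omega> K = {F. \<forall>j. F j \<in> components (closure \<Omega> - K j) \<and> F (Suc j) \<subseteq> F j}"

text \<open>Points of the closure are tagged with \<^const>\<open>Inl\<close>, ends with \<^const>\<open>Inr\<close>.\<close>

definition end_space :: "'x::topological_space set \<Rightarrow> (nat \<Rightarrow> 'x set) \<Rightarrow> ('x + (nat \<Rightarrow> 'x set)) set" where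
  "end_space \<Omega> K = Inl ` closure \<Omega> \<union> Inr ` ends \<Omega> K"

definition end_nbhd ::
    "'x::topological_space set \<Rightarrow> (nat \<Rightarrow> 'x set) \<Rightarrow> (nat \<Rightarrow> 'x set) \<Rightarrow> nat \<Rightarrow> ('x + (nat \<Rightarrow> 'x set)) set" where
  "end_nbhd \<Omega> K F j = Inl ` F j \<union> Inr ` {G \<in> ends \<Omega> K. \<forall>\<nu>\<le>j. G \<nu> = F \<nu>}"

definition end_open :: "'x::topological_space set \<Rightarrow> (nat \<Rightarrow> 'x set) \<Rightarrow> ('x + (nat \<Rightarrow> 'x set)) set \<Rightarrow> bool" where
  "end_open \<Omega> K W \<longleftrightarrow>
     W \<subseteq> end_space \<Omega> K \<and>
     (\<forall>x. Inl x \<in> W \<longrightarrow> (\<exists>U. open U \<and> x \<in> U \<and> Inl ` (U \<inter> closure \<Omega>) \<subseteq> W)) \<and>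
     (\<forall>F. Inr F \<in> W \<longrightarrow> (\<exists>j. end_nbhd \<Omega> K F j \<subseteq> W))"

text \<open>The open sets are those containing a basic set around each of their points.  If \<open>closure \<Omega>\<close>
  is not locally connected, \<open>F j\<close> need not be open in it, so that \<^term>\<open>end_nbhd \<Omega> K F j\<close> might
  fail to be a neighbourhood of the end \<open>F\<close>; it always is one when the space
  is sequentially compact.\<close>

definition end_topology ::
    "'x::topological_space set \<Rightarrow> (nat \<Rightarrow> 'x set) \<Rightarrow> ('x + (nat \<Rightarrow> 'x set)) topology" where
  "end_topology \<Omega> K = topology (end_open \<Omega> K)"

lemma end_nbhd_antimono:
  assumes "F \<in> ends \<Omega> K" "i \<le> j"
  shows "end_nbhd \<Omega> K F j \<subseteq> end_nbhd \<Omega> K F i"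
proof -
  have "F j \<subseteq> F i"
    by (rule lift_Suc_antimono_le[of F]) (use assms in \<open>simp_all add: ends_def\<close>)
  moreover have "{G \<in> ends \<Omega> K. \<forall>\<nu>\<le>j. G \<nu> = F \<nu>} \<subseteq> {G \<in> ends \<Omega> K. \<forall>\<nu>\<le>i. G \<nu> = F \<nu>}"
    using assms(2) order_trans by (intro Collect_mono) blast
  ultimately show ?thesis
    unfolding end_nbhd_def by (intro Un_mono image_mono)
qed

lemma end_openD:
  assumes "end_open \<Omega> K W"
  shows end_open_subset: "W \<subseteq> end_space \<Omega> K"
    and end_open_Inl: "Inl x \<in> W \<Longrightarrow> \<exists>U. open U \<and> x \<in> U \<and> Inl ` (U \<inter> closure \<Omega>) \<subseteq> W"
    and end_open_Inr: "Inr F \<in> W \<Longrightarrow> \<exists>j. end_nbhd \<Omega> K F j \<subseteq> W"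
  using assms unfolding end_open_def by simp_all

lemma end_openI:
  assumes "W \<subseteq> end_space \<Omega> K"
    and "\<And>x. Inl x \<in> W \<Longrightarrow> \<exists>U. open U \<and> x \<in> U \<and> Inl ` (U \<inter> closure \<Omega>) \<subseteq> W"
    and "\<And>F. Inr F \<in> W \<Longrightarrow> \<exists>j. end_nbhd \<Omega> K F j \<subseteq> W"
  shows "end_open \<Omega> K W"
  using assms unfolding end_open_def by simp

lemma end_open_Int:
  assumes S: "end_open \<Omega> K S" and T: "end_open \<Omega> K T"
  shows "end_open \<Omega> K (S \<inter> T)"
proof (rule end_openI)
  show "S \<inter> T \<subseteq> end_space \<Omega> K"
    using end_open_subset[OF S] by (rule le_infI1)
next
  fix x assume x: "Inl x \<in> S \<inter> T"
  obtain U where U: "open U" "x \<in> U" "Inl ` (U \<inter> closure \<Omega>) \<subseteq> S"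
    using end_open_Inl[OF S] IntD1[OF x] by metis
  obtain V where V: "open V" "x \<in> V" "Inl ` (V \<inter> closure \<Omega>) \<subseteq> T"
    using end_open_Inl[OF T] IntD2[OF x] by metis
  have "Inl ` (U \<inter> V \<inter> closure \<Omega>) \<subseteq> S \<inter> T"
    using U(3) V(3) by fast
  then show "\<exists>U. open U \<and> x \<in> U \<and> Inl ` (U \<inter> closure \<Omega>) \<subseteq> S \<inter> T"
    using U(1,2) V(1,2) by (intro exI[of _ "U \<inter> V"]) (simp add: open_Int)
next
  fix F assume F: "Inr F \<in> S \<inter> T"
  obtain i where i: "end_nbhd \<Omega> K F i \<subseteq> S"
    using end_open_Inr[OF S] IntD1[OF F] by metis
  obtain j where j: "end_nbhd \<Omega> K F j \<subseteq> T"
    using end_open_Inr[OF T] IntD2[OF F] by metis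
  have "F \<in> ends \<Omega> K"
    using subsetD[OF end_open_subset[OF S] IntD1[OF F]] by (auto simp: end_space_def)
  then have "end_nbhd \<Omega> K F (max i j) \<subseteq> S \<inter> T"
    using order_trans[OF end_nbhd_antimono i] order_trans[OF end_nbhd_antimono j] by simp
  then show "\<exists>j. end_nbhd \<Omega> K F j \<subseteq> S \<inter> T" ..
qed

lemma end_open_Union:
  assumes *: "\<And>S. S \<in> \<K> \<Longrightarrow> end_open \<Omega> K S"
  shows "end_open \<Omega> K (\<Union>\<K>)"
proof (rule end_openI)
  show "\<Union>\<K> \<subseteq> end_space \<Omega> K"
    using end_open_subset[OF *] by (rule Union_least)
next
  fix x assume "Inl x \<in> \<Union>\<K>"
  then obtain S where S: "S \<in> \<K>" "Inl x \<in> S"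
    by (rule UnionE)
  then obtain U where U: "open U" "x \<in> U" "Inl ` (U \<inter> closure \<Omega>) \<subseteq> S"
    using end_open_Inl[OF *] by metis
  then show "\<exists>U. open U \<and> x \<in> U \<and> Inl ` (U \<inter> closure \<Omega>) \<subseteq> \<Union>\<K>"
    using order_trans[OF U(3) Union_upper[OF S(1)]] by metis
next
  fix F assume "Inr F \<in> \<Union>\<K>"
  then obtain S where S: "S \<in> \<K>" "Inr F \<in> S"
    by (rule UnionE)
  then obtain j where j: "end_nbhd \<Omega> K F j \<subseteq> S"
    using end_open_Inr[OF *] by metis
  then show "\<exists>j. end_nbhd \<Omega> K F j \<subseteq> \<Union>\<K>"
    using order_trans[OF j Union_upper[OF S(1)]] by metis
qed

lemma openin_end_topology: "openin (end_topology \<Omega> K) = end_open \<Omega> K"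
proof -
  have "istopology (end_open \<Omega> K)"
    unfolding istopology_def by (simp add: end_open_Int end_open_Union)
  then show ?thesis
    by (simp add: end_topology_def)
qed

lemma topspace_end_topology: "topspace (end_topology \<Omega> K) = end_space \<Omega> K"
proof
  show "topspace (end_topology \<Omega> K) \<subseteq> end_space \<Omega> K"
    by (metis end_open_subset openin_end_topology openin_topspace)
  have "end_nbhd \<Omega> K F 0 \<subseteq> end_space \<Omega> K" if "F \<in> ends \<Omega> K" for F
  proof -
    have "F 0 \<subseteq> closure \<Omega>"
      using that in_components_subset by (fastforce simp: ends_def)
    then show ?thesis
      unfolding end_nbhd_def end_space_def by blast
  qed
  then have "\<exists>j. end_nbhd \<Omega> K F j \<subseteq> end_space \<Omega> K" if "Inr F \<in> end_space \<Omega> K" for F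
    using that by (intro exI[of _ 0]) (auto simp: end_space_def)
  moreover have "\<exists>U. open U \<and> x \<in> U \<and> Inl ` (U \<inter> closure \<Omega>) \<subseteq> end_space \<Omega> K" for x
    by (intro exI[of _ UNIV]) (auto simp: end_space_def)
  ultimately have "end_open \<Omega> K (end_space \<Omega> K)"
    by (intro end_openI order_refl)
  then show "end_space \<Omega> K \<subseteq> topspace (end_topology \<Omega> K)"
    by (simp add: openin_end_topology openin_subset)
qed

definition end_boundary :: "'x::topological_space set \<Rightarrow> (nat \<Rightarrow> 'x set) \<Rightarrow> ('x + (nat \<Rightarrow> 'x set)) set" where
  "end_boundary \<Omega> K = end_space \<Omega> K - Inl ` \<Omega>"

definition sequentially_compact_space :: "'a topology \<Rightarrow> bool" where
  "sequentially_compact_space T \<longleftrightarrow>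
     (\<forall>s::nat \<Rightarrow> _. range s \<subseteq> topspace T \<longrightarrow> (\<exists>l r. strict_mono r \<and> limitin T (s \<circ> r) l sequentially))"

text \<open>The filter \<open>w \<rightarrow> x\<close> with \<open>w\<close> ranging over \<open>\<Omega>\<close>.\<close>

definition toward_end ::
    "'x::topological_space set \<Rightarrow> (nat \<Rightarrow> 'x set) \<Rightarrow> ('x + (nat \<Rightarrow> 'x set)) \<Rightarrow> 'x filter" where
  "toward_end \<Omega> K x = filtercomap Inl (atin_within (end_topology \<Omega> K) x (Inl ` \<Omega>))"


section \<open>Metric compactification\<close>

text \<open>Functions on \<open>\<Omega>\<close> are represented extensionally.\<close>

definition cont_funs :: "'x::topological_space set \<Rightarrow> ('x \<Rightarrow> real) set" where
  "cont_funs \<Omega> = {f \<in> extensional \<Omega>. continuous_on \<Omega> f}"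

definition luc_open :: "'x::topological_space set \<Rightarrow> ('x \<Rightarrow> real) set \<Rightarrow> bool" where
  "luc_open \<Omega> W \<longleftrightarrow>
     W \<subseteq> cont_funs \<Omega> \<and>
     (\<forall>f\<in>W. \<exists>L \<epsilon>. compact L \<and> L \<subseteq> \<Omega> \<and> 0 < \<epsilon> \<and>
        {g \<in> cont_funs \<Omega>. \<forall>z\<in>L. \<bar>g z - f z\<bar> < \<epsilon>} \<subseteq> W)"

text \<open>Local uniform convergence on \<open>\<Omega>\<close> is uniform convergence on compact subsets, since manifolds
  are locally compact.\<close>

definition luc_topology :: "'x::topological_space set \<Rightarrow> ('x \<Rightarrow> real) topology" where
  "luc_topology \<Omega> = topology (luc_open \<Omega>)"

lemma openin_luc_topology: "openin (luc_topology \<Omega>) = luc_open \<Omega>"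
proof -
  have luc_openD: "\<exists>L \<epsilon>. compact L \<and> L \<subseteq> \<Omega> \<and> 0 < \<epsilon> \<and>
      {g \<in> cont_funs \<Omega>. \<forall>z\<in>L. \<bar>g z - f z\<bar> < \<epsilon>} \<subseteq> W"
    if "luc_open \<Omega> W" "f \<in> W" for W f
    using that unfolding luc_open_def by simp
  have luc_open_subset: "W \<subseteq> cont_funs \<Omega>" if "luc_open \<Omega> W" for W
    using that unfolding luc_open_def by simp
  have "luc_open \<Omega> (S \<inter> T)" if S: "luc_open \<Omega> S" and T: "luc_open \<Omega> T" for S T
    unfolding luc_open_def
  proof (intro conjI ballI)
    show "S \<inter> T \<subseteq> cont_funs \<Omega>"
      using luc_open_subset[OF S] by (rule le_infI1)
    fix f assume f: "f \<in> S \<inter> T"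
    obtain L \<epsilon> where L: "compact L" "L \<subseteq> \<Omega>" "0 < \<epsilon>"
        "{g \<in> cont_funs \<Omega>. \<forall>z\<in>L. \<bar>g z - f z\<bar> < \<epsilon>} \<subseteq> S"
      using luc_openD[OF S IntD1[OF f]] by (elim exE conjE) (rule that)
    obtain L' \<epsilon>' where L': "compact L'" "L' \<subseteq> \<Omega>" "0 < \<epsilon>'"
        "{g \<in> cont_funs \<Omega>. \<forall>z\<in>L'. \<bar>g z - f z\<bar> < \<epsilon>'} \<subseteq> T"
      using luc_openD[OF T IntD2[OF f]] by (elim exE conjE) (rule that)
    have "{g \<in> cont_funs \<Omega>. \<forall>z\<in>L \<union> L'. \<bar>g z - f z\<bar> < min \<epsilon> \<epsilon>'} \<subseteq> S \<inter> T"
      using L(4) L'(4) by (auto simp: subset_iff)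
    then show "\<exists>L \<epsilon>. compact L \<and> L \<subseteq> \<Omega> \<and> 0 < \<epsilon> \<and>
        {g \<in> cont_funs \<Omega>. \<forall>z\<in>L. \<bar>g z - f z\<bar> < \<epsilon>} \<subseteq> S \<inter> T"
      using L(1-3) L'(1-3)
      by (intro exI[of _ "L \<union> L'"] exI[of _ "min \<epsilon> \<epsilon>'"]) (simp add: compact_Un)
  qed
  moreover have "luc_open \<Omega> (\<Union>\<K>)" if *: "\<And>S. S \<in> \<K> \<Longrightarrow> luc_open \<Omega> S" for \<K>
    unfolding luc_open_def
  proof (intro conjI ballI)
    show "\<Union>\<K> \<subseteq> cont_funs \<Omega>"
      using luc_open_subset[OF *] by (rule Union_least)
    fix f assume "f \<in> \<Union>\<K>"
    then obtain S where S: "S \<in> \<K>" "f \<in> S"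
      by blast
    then obtain L \<epsilon> where "compact L" "L \<subseteq> \<Omega>" "0 < \<epsilon>"
        "{g \<in> cont_funs \<Omega>. \<forall>z\<in>L. \<bar>g z - f z\<bar> < \<epsilon>} \<subseteq> S"
      using luc_openD[OF *[OF S(1)] S(2)] by (elim exE conjE) (rule that)
    then show "\<exists>L \<epsilon>. compact L \<and> L \<subseteq> \<Omega> \<and> 0 < \<epsilon> \<and>
        {g \<in> cont_funs \<Omega>. \<forall>z\<in>L. \<bar>g z - f z\<bar> < \<epsilon>} \<subseteq> \<Union>\<K>"
      using S(1) by (intro exI[of _ L] exI[of _ \<epsilon>]) blast
  qed
  ultimately have "istopology (luc_open \<Omega>)"
    unfolding istopology_def by simp
  then show ?thesis
    by (simp add: luc_topology_def)
qed

lemma topspace_luc_topology: "topspace (luc_topology \<Omega>) = cont_funs \<Omega>"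
proof
  show "topspace (luc_topology \<Omega>) \<subseteq> cont_funs \<Omega>"
    using openin_topspace[of "luc_topology \<Omega>"] by (simp only: openin_luc_topology luc_open_def)
  have "luc_open \<Omega> (cont_funs \<Omega>)"
    unfolding luc_open_def by (auto intro!: exI[of _ "{}"] exI[of _ 1])
  then show "cont_funs \<Omega> \<subseteq> topspace (luc_topology \<Omega>)"
    by (simp add: openin_luc_topology openin_subset)
qed

text \<open>The class modulo constants of the restriction of \<open>f\<close> to \<open>\<Omega>\<close>.\<close>

definition const_class :: "'x::topological_space set \<Rightarrow> ('x \<Rightarrow> real) \<Rightarrow> ('x \<Rightarrow> real) set" where
  "const_class \<Omega> f = {g \<in> cont_funs \<Omega>. \<exists>c. \<forall>z\<in>\<Omega>. g z = f z + c}"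

definition quotient_open :: "'x::topological_space set \<Rightarrow> ('x \<Rightarrow> real) set set \<Rightarrow> bool" where
  "quotient_open \<Omega> W \<longleftrightarrow>
     W \<subseteq> const_class \<Omega> ` cont_funs \<Omega> \<and>
     openin (luc_topology \<Omega>) {f \<in> cont_funs \<Omega>. const_class \<Omega> f \<in> W}"

definition quotient_topology :: "'x::topological_space set \<Rightarrow> ('x \<Rightarrow> real) set topology" where
  "quotient_topology \<Omega> = topology (quotient_open \<Omega>)"

lemma openin_quotient_topology: "openin (quotient_topology \<Omega>) = quotient_open \<Omega>"
proof -
  have "quotient_open \<Omega> (S \<inter> T)" if "quotient_open \<Omega> S" "quotient_open \<Omega> T" for S T
  proof -
    have "{f \<in> cont_funs \<Omega>. const_class \<Omega> f \<in> S \<inter> T} =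
        {f \<in> cont_funs \<Omega>. const_class \<Omega> f \<in> S} \<inter> {f \<in> cont_funs \<Omega>. const_class \<Omega> f \<in> T}"
      by blast
    then show ?thesis
      using that by (simp add: quotient_open_def openin_Int le_infI1)
  qed
  moreover have "quotient_open \<Omega> (\<Union>\<K>)" if *: "\<And>S. S \<in> \<K> \<Longrightarrow> quotient_open \<Omega> S" for \<K>
  proof -
    have "{f \<in> cont_funs \<Omega>. const_class \<Omega> f \<in> \<Union>\<K>} =
        (\<Union>S\<in>\<K>. {f \<in> cont_funs \<Omega>. const_class \<Omega> f \<in> S})"
      by blast
    moreover have "openin (luc_topology \<Omega>) (\<Union>S\<in>\<K>. {f \<in> cont_funs \<Omega>. const_class \<Omega> f \<in> S})"
      using * unfolding quotient_open_def by (intro openin_Union) auto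
    ultimately show ?thesis
      using * unfolding quotient_open_def by (simp add: Sup_least)
  qed
  ultimately have "istopology (quotient_open \<Omega>)"
    unfolding istopology_def by simp
  then show ?thesis
    by (simp add: quotient_topology_def)
qed

lemma topspace_quotient_topology:
  "topspace (quotient_topology \<Omega>) = const_class \<Omega> ` cont_funs \<Omega>"
proof
  show "topspace (quotient_topology \<Omega>) \<subseteq> const_class \<Omega> ` cont_funs \<Omega>"
    using openin_topspace[of "quotient_topology \<Omega>"]
    by (simp only: openin_quotient_topology quotient_open_def)
  have "{f \<in> cont_funs \<Omega>. const_class \<Omega> f \<in> const_class \<Omega> ` cont_funs \<Omega>}
      = topspace (luc_topology \<Omega>)"
    by (auto simp: topspace_luc_topology)
  then have "quotient_open \<Omega> (const_class \<Omega> ` cont_funs \<Omega>)"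
    unfolding quotient_open_def by (metis openin_topspace order_refl)
  then show "const_class \<Omega> ` cont_funs \<Omega> \<subseteq> topspace (quotient_topology \<Omega>)"
    by (simp add: openin_quotient_topology openin_subset)
qed

lemma quotient_map_const_class:
  "quotient_map (luc_topology \<Omega>) (quotient_topology \<Omega>) (const_class \<Omega>)"
  unfolding quotient_map_def
  by (auto simp: topspace_luc_topology topspace_quotient_topology openin_quotient_topology
      quotient_open_def)

definition kobayashi_embed :: "('x::topological_space, 'n::finite) atlas \<Rightarrow> 'x set \<Rightarrow> 'x \<Rightarrow> ('x \<Rightarrow> real) set" where
  "kobayashi_embed A \<Omega> x = const_class \<Omega> (kobayashi A \<Omega> x)"

definition metric_compactification :: "('x::topological_space, 'n::finite) atlas \<Rightarrow> 'x set \<Rightarrow> ('x \<Rightarrow> real) set set" where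
  "metric_compactification A \<Omega> = quotient_topology \<Omega> closure_of (kobayashi_embed A \<Omega> ` \<Omega>)"

definition metric_boundary :: "('x::topological_space, 'n::finite) atlas \<Rightarrow> 'x set \<Rightarrow> ('x \<Rightarrow> real) set set" where
  "metric_boundary A \<Omega> = metric_compactification A \<Omega> - kobayashi_embed A \<Omega> ` \<Omega>"

definition horofunction :: "'x \<Rightarrow> ('x \<Rightarrow> real) set \<Rightarrow> 'x \<Rightarrow> real" where
  "horofunction p \<xi> = (THE h. h \<in> \<xi> \<and> h p = 0)"


section \<open>Horospheres\<close>

definition horosphere :: "'x set \<Rightarrow> 'x \<Rightarrow> ('x \<Rightarrow> real) set \<Rightarrow> real \<Rightarrow> 'x set" where
  "horosphere \<Omega> p \<xi> R = {z \<in> \<Omega>. horofunction p \<xi> z < 1/2 * ln R}"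

definition horofunctions_at ::
    "('x::topological_space, 'n::finite) atlas \<Rightarrow> 'x set \<Rightarrow> (nat \<Rightarrow> 'x set) \<Rightarrow>
     ('x + (nat \<Rightarrow> 'x set)) \<Rightarrow> ('x \<Rightarrow> real) set set" where
  "horofunctions_at A \<Omega> K x =
     {\<xi> \<in> metric_boundary A \<Omega>.
        \<exists>s. range s \<subseteq> \<Omega> \<and>
            limitin (end_topology \<Omega> K) (Inl \<circ> s) x sequentially \<and>
            limitin (quotient_topology \<Omega>) (kobayashi_embed A \<Omega> \<circ> s) \<xi> sequentially}"

definition big_horosphere ::
    "('x::topological_space, 'n::finite) atlas \<Rightarrow> 'x set \<Rightarrow> (nat \<Rightarrow> 'x set) \<Rightarrow> 'x \<Rightarrow>
     ('x + (nat \<Rightarrow> 'x set)) \<Rightarrow> real \<Rightarrow> 'x set" where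
  "big_horosphere A \<Omega> K p x R =
     {z \<in> \<Omega>. Liminf (toward_end \<Omega> K x) (\<lambda>w. ereal (kobayashi A \<Omega> z w - kobayashi A \<Omega> p w))
              < ereal (1/2 * ln R)}"

definition small_horosphere ::
    "('x::topological_space, 'n::finite) atlas \<Rightarrow> 'x set \<Rightarrow> (nat \<Rightarrow> 'x set) \<Rightarrow> 'x \<Rightarrow>
     ('x + (nat \<Rightarrow> 'x set)) \<Rightarrow> real \<Rightarrow> 'x set" where
  "small_horosphere A \<Omega> K p x R =
     {z \<in> \<Omega>. Limsup (toward_end \<Omega> K x) (\<lambda>w. ereal (kobayashi A \<Omega> z w - kobayashi A \<Omega> p w))
              < ereal (1/2 * ln R)}"

end

theory Submission
  imports Defs "HOL-Complex_Analysis.Riemann_Mapping"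
begin

text \<open>
  The argument is Wolff's lemma for a map that does not increase an escaping distance.  Write \<open>k\<close>
  for the Kobayashi distance.  Since \<open>k\<close> is complete and inner, its closed balls are compact
  (\<open>hopf_rinow\<close>), so compact divergence of the iterates forces \<open>k p (f\<^sup>n p)\<close> to tend to infinity.
  Hence each natural number \<open>j\<close> has a last time \<open>N\<close> with \<open>k p (f\<^sup>N p) \<le> j\<close>; put \<open>u = f\<^sup>N p\<close>.  No later
  point of the orbit is closer to \<open>p\<close> than \<open>u\<close>, and holomorphic maps do not increase \<open>k\<close>.  Subtracting
  \<open>k p u \<le> k p (f\<^sup>n u)\<close> from \<open>k (f\<^sup>n z) (f\<^sup>n u) \<le> k z u\<close> gives, for all \<open>n\<close> and \<open>z\<close>,
  \<open>k (f\<^sup>n z) (f\<^sup>n u) - k p (f\<^sup>n u) \<le> k z u - k p u\<close>.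

  Let \<open>j\<close> run to infinity and pass to a subsequence along which \<open>u\<close> converges to a point \<open>x\<close> of the
  end compactification and the right-hand side converges locally uniformly to a horofunction \<open>h\<close>
  (\<open>horofunction_subsequence\<close>).  The points \<open>f\<^sup>n u\<close> stay within \<open>k p (f\<^sup>n p)\<close> of \<open>u\<close>, and two
  escaping sequences at bounded distance have the same limit (\<open>bounded_distance_same_limit\<close>); so
  \<open>f\<^sup>n u\<close> also tends to \<open>x\<close>, and the lower limit defining the big horosphere at \<open>x\<close> is, at \<open>f\<^sup>n z\<close>, at
  most \<open>h z\<close>.  This is the first inclusion.  The second follows because \<open>h\<close>, being a limit along
  one sequence tending to \<open>x\<close>, is bounded by the upper limit that defines small horospheres.

  Two facts carry the topology.  First, a hyperbolic Kobayashi distance induces the manifold topology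
  and nearly realises distances along connected sets (\<open>kobayashi_inner_metric\<close>).  Second, the
  equality of limits: nearby escaping points are joined by connected sets of bounded size, and if such
  sets crossed a compact shell of \<open>closure \<Omega>\<close> infinitely often they would accumulate at two
  different boundary points that remain at bounded distance, against the hypothesis on
  \<open>frontier \<Omega>\<close> (\<open>connected_sets_do_not_cross\<close>).  So if one of the two sequences tends to an end, then both
  eventually lie in the same component of the complement of each \<open>K j\<close>.  That a sequence converging
  to an end lies eventually in each of its components follows from sequential compactness (\<open>end_component_open\<close>).
\<close>

text \<open>The dollar sign denotes vector components only, not coefficients of power series.\<close>

no_notation fps_nth (infixl \<open>$\<close> 75)

section \<open>Inner metrics and the Hopf-Rinow theorem\<close>

text \<open>Connected sets take the place of curves: they are what unions of images of discs produce most
  directly, and connectedness is all that intermediate value and boundary crossing arguments use.\<close>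

locale inner_metric = Metric_space \<Omega> d
  for \<Omega> :: "'x::{t2_space, second_countable_topology} set" and d +
  assumes mtopology_eq: "mtopology = top_of_set \<Omega>"
    and locally_compact: "z \<in> \<Omega> \<Longrightarrow> \<exists>r>0. compactin mtopology (mcball z r)"
    and near_geodesic: "\<lbrakk>z \<in> \<Omega>; w \<in> \<Omega>; e > 0\<rbrakk> \<Longrightarrow>
      \<exists>S. connected S \<and> S \<subseteq> \<Omega> \<and> z \<in> S \<and> w \<in> S \<and> (\<forall>u\<in>S. d z u + d u w < d z w + e)"
begin

lemma open_around_in_mball:
  assumes "z \<in> \<Omega>" "e > 0"
  obtains U where "open U" "z \<in> U" "U \<inter> \<Omega> = mball z e"
proof -
  have "openin (top_of_set \<Omega>) (mball z e)"
    using openin_mball mtopology_eq by metis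
  then show ?thesis
    using that assms centre_in_mball_iff by (metis Int_commute IntD2 openin_open)
qed

lemma abs_dist_diff_le:
  assumes "q \<in> \<Omega>" "z \<in> \<Omega>" "w \<in> \<Omega>"
  shows "\<bar>d q z - d q w\<bar> \<le> d z w"
  using triangle[OF assms] triangle[OF assms(1,3,2)] commute[of z w] by linarith

lemma lipschitz_imp_continuous_on:
  fixes h :: "'x \<Rightarrow> real"
  assumes "\<And>z w. \<lbrakk>z \<in> \<Omega>; w \<in> \<Omega>\<rbrakk> \<Longrightarrow> \<bar>h z - h w\<bar> \<le> d z w"
  shows "continuous_on \<Omega> h"
  unfolding continuous_on
proof (intro ballI tendstoI)
  fix x and e :: real
  assume x: "x \<in> \<Omega>" and e: "e > 0"
  obtain U where U: "open U" "x \<in> U" "U \<inter> \<Omega> = mball x e"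
    using open_around_in_mball[OF x e] .
  have "dist (h y) (h x) < e" if "y \<in> U" "y \<in> \<Omega>" for y
  proof -
    have "d x y < e"
      using U(3) that by (metis IntI in_mball)
    then show ?thesis
      using assms[OF \<open>y \<in> \<Omega>\<close> x] commute[of x y] by (simp add: dist_real_def)
  qed
  then show "\<forall>\<^sub>F y in at x within \<Omega>. dist (h y) (h x) < e"
    unfolding eventually_at_topological using U by blast
qed

lemma continuous_on_dist:
  assumes "q \<in> \<Omega>"
  shows "continuous_on \<Omega> (d q)"
  using abs_dist_diff_le[OF assms] by (rule lipschitz_imp_continuous_on)

text \<open>The distance from \<open>z\<close> takes every intermediate value on a nearly geodesic connected set.\<close>

lemma point_at_distance:
  assumes "z \<in> \<Omega>" "w \<in> \<Omega>" "0 \<le> t" "t \<le> d z w" "e > 0"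
  obtains u where "u \<in> \<Omega>" "d z u = t" "d u w < d z w - t + e"
proof -
  obtain S where S: "connected S" "S \<subseteq> \<Omega>" "z \<in> S" "w \<in> S"
    "\<And>u. u \<in> S \<Longrightarrow> d z u + d u w < d z w + e"
    using near_geodesic[OF assms(1,2,5)] by blast
  have "connected (d z ` S)"
    using S continuous_on_subset continuous_on_dist assms(1) connected_continuous_image by blast
  moreover have "0 \<in> d z ` S" "d z w \<in> d z ` S"
    using S mdist_zero assms(1) by (metis imageI)+
  ultimately have "t \<in> d z ` S"
    using assms(3,4) by (meson connectedD_interval)
  then obtain u where "u \<in> S" "d z u = t"
    by blast
  then show ?thesis
    using S that by (smt (verit) subsetD)
qed

text \<open>A point slightly outside the compact ball is close to a point of the ball, because one can stop at
  distance \<open>R\<close> on the way from \<open>p\<close>; finitely many compact balls around points of the ball thus also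
  cover a slightly larger ball.\<close>

lemma compactin_mcball_extend:
  assumes "p \<in> \<Omega>" "R \<ge> 0" "compactin mtopology (mcball p R)"
  shows "\<exists>\<delta>>0. compactin mtopology (mcball p (R + \<delta>))"
proof -
  obtain r where r: "\<And>y. y \<in> \<Omega> \<Longrightarrow> r y > 0" "\<And>y. y \<in> \<Omega> \<Longrightarrow> compactin mtopology (mcball y (r y))"
    using locally_compact by metis
  let ?\<U> = "(\<lambda>y. mball y (r y / 2)) ` mcball p R"
  have "y \<in> mball y (r y / 2)" if "y \<in> mcball p R" for y
    using that r(1)[of y] by simp
  then have "mcball p R \<subseteq> \<Union>?\<U>"
    by blast
  moreover have "\<forall>U\<in>?\<U>. openin mtopology U"
    by auto
  ultimately have "\<exists>\<F>. finite \<F> \<and> \<F> \<subseteq> ?\<U> \<and> mcball p R \<subseteq> \<Union>\<F>"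
    using assms(3) unfolding compactin_def by auto
  then obtain Y where Y: "finite Y" "Y \<subseteq> mcball p R" "mcball p R \<subseteq> (\<Union>y\<in>Y. mball y (r y / 2))"
    by (metis (no_types, lifting) finite_subset_image)
  \<comment> \<open>a point of the larger ball is within \<open>2 * \<delta>\<close> of the smaller one, which must fit into the unused half of \<open>r y\<close>\<close>
  define \<delta> where "\<delta> = Min (insert 1 ((\<lambda>y. r y / 4) ` Y))"
  have Y\<Omega>: "Y \<subseteq> \<Omega>"
    using Y(2) by auto
  have "\<delta> > 0"
    unfolding \<delta>_def using Y(1) Y\<Omega> r(1) by (subst Min_gr_iff) auto
  have \<delta>: "\<delta> \<le> r y / 4" if "y \<in> Y" for y
    unfolding \<delta>_def using Y(1) that by (intro Min_le) auto
  have "x \<in> (\<Union>y\<in>Y. mcball y (r y))" if x: "x \<in> mcball p (R + \<delta>)" for x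
  proof -
    have "x \<in> \<Omega>" "d p x \<le> R + \<delta>"
      using x by auto
    obtain u where u: "u \<in> \<Omega>" "d p u \<le> R" "d u x \<le> 2 * \<delta>"
    proof (cases "d p x \<le> R")
      case True
      then show ?thesis
        using that[of x] \<open>x \<in> \<Omega>\<close> \<open>\<delta> > 0\<close> mdist_zero by simp
    next
      case False
      then obtain u where "u \<in> \<Omega>" "d p u = R" "d u x < d p x - R + \<delta>"
        using point_at_distance[OF assms(1) \<open>x \<in> \<Omega>\<close> assms(2) _ \<open>\<delta> > 0\<close>] by auto
      then show ?thesis
        using that[of u] \<open>d p x \<le> R + \<delta>\<close> by simp
    qed
    then have "u \<in> mcball p R"
      using assms(1) by simp
    then obtain y where y: "y \<in> Y" "u \<in> mball y (r y / 2)"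
      using Y(3) by blast
    then have "d y x \<le> d y u + d u x" "d y u < r y / 2"
      using triangle u(1) \<open>x \<in> \<Omega>\<close> by auto
    then have "d y x \<le> r y"
      using \<delta>[OF y(1)] u(3) by linarith
    then show ?thesis
      using y(1) \<open>x \<in> \<Omega>\<close> Y\<Omega> by auto
  qed
  then have "mcball p (R + \<delta>) \<subseteq> (\<Union>y\<in>Y. mcball y (r y))"
    by blast
  moreover have "compactin mtopology (\<Union>y\<in>Y. mcball y (r y))"
    using Y(1) Y\<Omega> r(2) by (intro compactin_Union) auto
  ultimately show ?thesis
    using closed_compactin closedin_mcball \<open>\<delta> > 0\<close> by blast
qed

text \<open>Every point of the ball is close to a point of a slightly smaller, compact one, which makes the ball
  totally bounded; completeness does the rest.\<close>

lemma compactin_mcball_limit: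
  assumes "mcomplete" "p \<in> \<Omega>" "R > 0" and less: "\<And>r. r < R \<Longrightarrow> compactin mtopology (mcball p r)"
  shows "compactin mtopology (mcball p R)"
proof -
  have "mtotally_bounded (mcball p R)"
    unfolding mtotally_bounded_def
  proof (intro allI impI)
    fix \<epsilon> :: real
    assume "\<epsilon> > 0"
    define r where "r = max 0 (R - \<epsilon> / 3)"
    have r: "r \<ge> 0" "r < R" "R - r \<le> \<epsilon> / 3"
      unfolding r_def using \<open>\<epsilon> > 0\<close> assms(3) by (auto simp: max_def)
    have "mtotally_bounded (mcball p r)"
      using less[OF r(2)] compactin_imp_mtotally_bounded by blast
    then obtain Y where Y: "finite Y" "Y \<subseteq> mcball p r" "mcball p r \<subseteq> (\<Union>x\<in>Y. mball x (\<epsilon> / 3))"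
      unfolding mtotally_bounded_def using \<open>\<epsilon> > 0\<close> by (metis divide_pos_pos zero_less_numeral)
    have "x \<in> (\<Union>y\<in>Y. mball y \<epsilon>)" if x: "x \<in> mcball p R" for x
    proof -
      have "x \<in> \<Omega>" "d p x \<le> R"
        using x by auto
      obtain u where u: "u \<in> \<Omega>" "d p u \<le> r" "d u x < 2 * \<epsilon> / 3"
      proof (cases "d p x \<le> r")
        case True
        then show ?thesis
          using that[of x] \<open>x \<in> \<Omega>\<close> \<open>\<epsilon> > 0\<close> mdist_zero by simp
      next
        case False
        then obtain u where "u \<in> \<Omega>" "d p u = r" "d u x < d p x - r + \<epsilon> / 3"
          using point_at_distance[OF assms(2) \<open>x \<in> \<Omega>\<close> r(1), of "\<epsilon> / 3"] \<open>\<epsilon> > 0\<close> by auto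
        then show ?thesis
          using that[of u] \<open>d p x \<le> R\<close> r(3) by simp
      qed
      then have "u \<in> mcball p r"
        using assms(2) by simp
      then obtain y where y: "y \<in> Y" "u \<in> mball y (\<epsilon> / 3)"
        using Y(3) by blast
      then have "d y x \<le> d y u + d u x" "d y u < \<epsilon> / 3"
        using triangle u(1) \<open>x \<in> \<Omega>\<close> by auto
      then have "d y x < \<epsilon>"
        using u(3) by linarith
      then show ?thesis
        using y \<open>x \<in> \<Omega>\<close> by auto
    qed
    moreover have "Y \<subseteq> mcball p R"
      using Y(2) r(2) by auto
    ultimately show "\<exists>K. finite K \<and> K \<subseteq> mcball p R \<and> mcball p R \<subseteq> (\<Union>x\<in>K. mball x \<epsilon>)"
      using Y(1) by blast
  qed
  then have "compactin mtopology (mtopology closure_of mcball p R)"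
    using mtotally_bounded_eq_compact_closure_of assms(1) by blast
  then show ?thesis
    by (simp add: closure_of_closedin)
qed

text \<open>The set of radii with compact closed ball is an initial segment that contains its supremum and can
  be extended beyond it, so it is unbounded.\<close>

theorem hopf_rinow:
  assumes "mcomplete" "p \<in> \<Omega>"
  shows "compact (mcball p R)"
proof -
  let ?P = "\<lambda>r. compactin mtopology (mcball p r)"
  have mono: "?P r" if "?P s" "r \<le> s" for r s
    by (rule closed_compactin[OF that(1) _ closedin_mcball]) (use that(2) in auto)
  have "?P R"
  proof (rule ccontr)
    assume not: "\<not> ?P R"
    let ?S = "{r. ?P r}"
    have "mcball p 0 = {p}"
      using assms(2) zero by (auto simp: order_antisym_conv)
    then have S0: "0 \<in> ?S"
      using assms(2) by simp
    have bdd: "bdd_above ?S"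
      using mono not by (intro bdd_aboveI[of _ R]) (metis linear mem_Collect_eq)
    obtain \<delta> where \<delta>: "\<delta> > 0" "?P (0 + \<delta>)"
      using compactin_mcball_extend[OF assms(2) order_refl] S0 by blast
    define s where "s = Sup ?S"
    have "s > 0"
      unfolding s_def using cSup_upper[OF _ bdd, of \<delta>] \<delta> by simp
    moreover have "?P r" if "r < s" for r
      using that less_cSup_iff[OF _ bdd] S0 mono unfolding s_def
      by (metis empty_iff less_imp_le mem_Collect_eq)
    ultimately have "?P s"
      using compactin_mcball_limit[OF assms] by blast
    then obtain \<delta>' where \<delta>': "\<delta>' > 0" "?P (s + \<delta>')"
      using compactin_mcball_extend[OF assms(2)] \<open>s > 0\<close> by (metis less_imp_le)
    have "s + \<delta>' \<le> Sup ?S"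
      by (intro cSup_upper bdd) (use \<delta>'(2) in simp)
    then show False
      using \<delta>'(1) unfolding s_def by simp
  qed
  then show ?thesis
    by (simp add: mtopology_eq compactin_subtopology)
qed

end

section \<open>Holomorphic discs in a complex manifold\<close>

lemma cvec_norm_scale: "norm (c *s v) = cmod c * norm (v :: complex^'n)"
  by (simp add: norm_vec_def L2_set_def norm_mult power_mult_distrib real_sqrt_mult
      flip: sum_distrib_left)

lemma holomorphic_on_locallyI:
  assumes "\<And>z. z \<in> S \<Longrightarrow> \<exists>T. open T \<and> z \<in> T \<and> h holomorphic_on T"
  shows "h holomorphic_on S"
  unfolding holomorphic_on_def
  using assms holomorphic_on_imp_differentiable_at field_differentiable_at_within by blast

text \<open>The chain rule: a complex-linear derivative sends the velocity \<open>h *s v\<close> of the curve to \<open>h *s D v\<close>, so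
  the components of the composition have complex derivatives.\<close>

lemma cvec_holomorphic_compose:
  fixes F :: "complex^'n \<Rightarrow> complex^'m" and \<gamma> :: "complex \<Rightarrow> complex^'n"
  assumes F: "cvec_holomorphic_on F S" and "open T" and \<gamma>: "\<And>j. (\<lambda>\<zeta>. \<gamma> \<zeta> $ j) holomorphic_on T"
    and sub: "\<gamma> ` T \<subseteq> S"
  shows "(\<lambda>\<zeta>. F (\<gamma> \<zeta>) $ i) holomorphic_on T"
  unfolding holomorphic_on_open[OF \<open>open T\<close>]
proof
  fix \<zeta> assume "\<zeta> \<in> T"
  then obtain D where D: "(F has_derivative D) (at (\<gamma> \<zeta>))" "\<And>c v. D (c *s v) = c *s D v"
    using F sub unfolding cvec_holomorphic_on_def by blast
  define v where "v = (\<chi> j. deriv (\<lambda>\<zeta>. \<gamma> \<zeta> $ j) \<zeta>)"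
  have comp: "((\<lambda>\<zeta>. \<gamma> \<zeta> $ j) has_derivative (\<lambda>h. h * v $ j)) (at \<zeta>)" for j
    using holomorphic_derivI[OF \<gamma> \<open>open T\<close> \<open>\<zeta> \<in> T\<close>, of j]
    unfolding has_field_derivative_def v_def by (simp add: mult.commute[of _ "deriv _ _"])
  have "(\<gamma> has_derivative (\<lambda>h. h *s v)) (at \<zeta>)"
    unfolding has_derivative_componentwise_within[of \<gamma>]
  proof
    fix b :: "complex^'n" assume "b \<in> Basis"
    then obtain j u where b: "b = axis j u"
      by (auto simp: Basis_vec_def)
    show "((\<lambda>x. \<gamma> x \<bullet> b) has_derivative (\<lambda>x. (x *s v) \<bullet> b)) (at \<zeta>)"
      unfolding b inner_axis vector_smult_component by (intro has_derivative_inner_left comp)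
  qed
  then have "((\<lambda>\<zeta>. F (\<gamma> \<zeta>)) has_derivative (\<lambda>h. D (h *s v))) (at \<zeta>)"
    using has_derivative_compose D(1) by blast
  then have "((\<lambda>\<zeta>. F (\<gamma> \<zeta>) $ i) has_derivative (\<lambda>h. D (h *s v) $ i)) (at \<zeta>)"
    by (rule bounded_linear.has_derivative[OF bounded_linear_vec_nth])
  then have "((\<lambda>\<zeta>. F (\<gamma> \<zeta>) $ i) has_field_derivative (D v $ i)) (at \<zeta>)"
    unfolding has_field_derivative_def D(2) vector_smult_component
    by (simp add: mult.commute[of _ "D v $ i"])
  then show "\<exists>f'. ((\<lambda>\<zeta>. F (\<gamma> \<zeta>) $ i) has_field_derivative f') (at \<zeta>)" ..
qed

lemma complex_manifoldD:
  assumes "complex_manifold A" "(U, \<phi>) \<in> A"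
  shows chart_open: "open U" and chart_open_image: "open (\<phi> ` U)"
    and chart_homeomorphism: "homeomorphism U (\<phi> ` U) \<phi> (inv_into U \<phi>)"
    and chart_transition: "(V, \<psi>) \<in> A \<Longrightarrow> cvec_holomorphic_on (\<psi> \<circ> inv_into U \<phi>) (\<phi> ` (U \<inter> V))"
  using assms unfolding complex_manifold_def by fast+

lemma complex_manifold_chart_at:
  assumes "complex_manifold A"
  obtains U \<phi> where "(U, \<phi>) \<in> A" "z \<in> U"
proof -
  have "z \<in> \<Union> (fst ` A)"
    using assms unfolding complex_manifold_def by blast
  then show ?thesis
    using that by auto
qed

lemma open_disc_preimage:
  assumes "holomorphic_disc A \<Omega> g" "open V"
  shows "open (ball 0 1 \<inter> g -` V)"
  using assms continuous_open_preimage unfolding holomorphic_disc_def by blast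

text \<open>Holomorphy of \<open>f \<circ> g\<close> is local, and near each parameter \<open>g\<close> stays in a single chart, where the
  chain rule applies.\<close>

lemma holomorphic_disc_compose_self_map:
  assumes "complex_manifold A" and g: "holomorphic_disc A \<Omega> g" and f: "holomorphic_self_map A \<Omega> f"
  shows "holomorphic_disc A \<Omega> (f \<circ> g)"
  unfolding holomorphic_disc_def
proof (intro conjI)
  have g\<Omega>: "g ` ball 0 1 \<subseteq> \<Omega>" and contg: "continuous_on (ball 0 1) g"
    using g unfolding holomorphic_disc_def by auto
  have f\<Omega>: "f ` \<Omega> \<subseteq> \<Omega>" and contf: "continuous_on \<Omega> f"
    using f unfolding holomorphic_self_map_def by auto
  show "(f \<circ> g) ` ball 0 1 \<subseteq> \<Omega>"
    using g\<Omega> f\<Omega> by auto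
  show contfg: "continuous_on (ball 0 1) (f \<circ> g)"
    by (rule continuous_on_compose[OF contg continuous_on_subset[OF contf g\<Omega>]])
  have "(\<lambda>\<zeta>. \<psi> ((f \<circ> g) \<zeta>) $ i) holomorphic_on (ball 0 1 \<inter> (f \<circ> g) -` V)"
    if V: "(V, \<psi>) \<in> A" for V \<psi> i
  proof (rule holomorphic_on_locallyI)
    fix \<zeta> assume \<zeta>: "\<zeta> \<in> ball 0 1 \<inter> (f \<circ> g) -` V"
    obtain U \<phi> where U: "(U, \<phi>) \<in> A" "g \<zeta> \<in> U"
      using complex_manifold_chart_at[OF assms(1)] .
    define T where "T = (ball 0 1 \<inter> (f \<circ> g) -` V) \<inter> (ball 0 1 \<inter> g -` U)"
    have "open T"
      unfolding T_def
      by (intro open_Int open_disc_preimage[OF g] continuous_open_preimage[OF contfg]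
          chart_open[OF assms(1) U(1)] chart_open[OF assms(1) V]) simp
    have "(\<lambda>\<zeta>. (\<psi> \<circ> f \<circ> inv_into U \<phi>) ((\<phi> \<circ> g) \<zeta>) $ i) holomorphic_on T"
    proof (rule cvec_holomorphic_compose[where F = "\<psi> \<circ> f \<circ> inv_into U \<phi>" and \<gamma> = "\<phi> \<circ> g"])
      show "cvec_holomorphic_on (\<psi> \<circ> f \<circ> inv_into U \<phi>) (\<phi> ` (U \<inter> \<Omega> \<inter> f -` V))"
        using f U(1) V unfolding holomorphic_self_map_def by blast
      show "(\<lambda>\<zeta>. (\<phi> \<circ> g) \<zeta> $ j) holomorphic_on T" for j
      proof (rule holomorphic_on_subset)
        show "(\<lambda>\<zeta>. (\<phi> \<circ> g) \<zeta> $ j) holomorphic_on (ball 0 1 \<inter> g -` U)"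
          using g U(1) unfolding holomorphic_disc_def by fastforce
      qed (auto simp: T_def)
      show "(\<phi> \<circ> g) ` T \<subseteq> \<phi> ` (U \<inter> \<Omega> \<inter> f -` V)"
        using g\<Omega> unfolding T_def by auto
    qed (fact \<open>open T\<close>)
    moreover have "(\<psi> \<circ> f \<circ> inv_into U \<phi>) ((\<phi> \<circ> g) \<eta>) $ i = \<psi> ((f \<circ> g) \<eta>) $ i" if "\<eta> \<in> T" for \<eta>
      using that homeomorphism_apply1[OF chart_homeomorphism[OF assms(1) U(1)], of "g \<eta>"]
      unfolding T_def by auto
    ultimately have "(\<lambda>\<zeta>. \<psi> ((f \<circ> g) \<zeta>) $ i) holomorphic_on T"
      by (rule holomorphic_transform)
    moreover have "\<zeta> \<in> T"
      using \<zeta> U(2) unfolding T_def by auto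
    ultimately show "\<exists>T. open T \<and> \<zeta> \<in> T \<and> (\<lambda>\<zeta>. \<psi> ((f \<circ> g) \<zeta>) $ i) holomorphic_on T"
      using \<open>open T\<close> by blast
  qed
  then show "\<forall>(V, \<psi>)\<in>A. \<forall>i. (\<lambda>\<zeta>. \<psi> ((f \<circ> g) \<zeta>) $ i) holomorphic_on (ball 0 1 \<inter> (f \<circ> g) -` V)"
    by blast
qed

lemma holomorphic_disc_reparametrise:
  assumes g: "holomorphic_disc A \<Omega> g" and m: "m holomorphic_on ball 0 1" "m ` ball 0 1 \<subseteq> ball 0 1"
  shows "holomorphic_disc A \<Omega> (g \<circ> m)"
  unfolding holomorphic_disc_def
proof (intro conjI)
  have g\<Omega>: "g ` ball 0 1 \<subseteq> \<Omega>" and contg: "continuous_on (ball 0 1) g"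
    using g unfolding holomorphic_disc_def by auto
  show "(g \<circ> m) ` ball 0 1 \<subseteq> \<Omega>"
    using g\<Omega> m(2) by (auto simp: image_subset_iff)
  show "continuous_on (ball 0 1) (g \<circ> m)"
    by (rule continuous_on_compose[OF holomorphic_on_imp_continuous_on[OF m(1)]
          continuous_on_subset[OF contg m(2)]])
  have "(\<lambda>\<zeta>. \<phi> ((g \<circ> m) \<zeta>) $ i) holomorphic_on (ball 0 1 \<inter> (g \<circ> m) -` U)"
    if "(U, \<phi>) \<in> A" for U \<phi> i
  proof -
    have "(\<lambda>\<zeta>. \<phi> (g \<zeta>) $ i) holomorphic_on (ball 0 1 \<inter> g -` U)"
      using g that unfolding holomorphic_disc_def by blast
    moreover have "m holomorphic_on (ball 0 1 \<inter> (g \<circ> m) -` U)"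
      using m(1) by (rule holomorphic_on_subset) auto
    moreover have "m ` (ball 0 1 \<inter> (g \<circ> m) -` U) \<subseteq> ball 0 1 \<inter> g -` U"
      using m(2) by auto
    ultimately have "((\<lambda>\<zeta>. \<phi> (g \<zeta>) $ i) \<circ> m) holomorphic_on (ball 0 1 \<inter> (g \<circ> m) -` U)"
      using holomorphic_on_compose_gen by blast
    then show ?thesis
      by (simp add: o_def)
  qed
  then show "\<forall>(U, \<phi>)\<in>A. \<forall>i. (\<lambda>\<zeta>. \<phi> ((g \<circ> m) \<zeta>) $ i) holomorphic_on (ball 0 1 \<inter> (g \<circ> m) -` U)"
    by blast
qed

lemma holomorphic_disc_in_chart:
  fixes \<gamma> :: "complex \<Rightarrow> complex^'n"
  assumes "complex_manifold A" "(U, \<phi>) \<in> A" and \<gamma>: "\<And>j. (\<lambda>\<zeta>. \<gamma> \<zeta> $ j) holomorphic_on ball 0 1"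
    and sub: "\<gamma> ` ball 0 1 \<subseteq> \<phi> ` (U \<inter> \<Omega>)"
  shows "holomorphic_disc A \<Omega> (inv_into U \<phi> \<circ> \<gamma>)"
  unfolding holomorphic_disc_def
proof (intro conjI)
  note hom = chart_homeomorphism[OF assms(1,2)]
  have inv: "inv_into U \<phi> (\<phi> x) = x" if "x \<in> U" for x
    using homeomorphism_apply1[OF hom that] .
  have sub': "\<gamma> ` ball 0 1 \<subseteq> \<phi> ` U"
    using sub by (rule order_trans) (rule image_mono, rule Int_lower1)
  have lift: "\<exists>u. u \<in> U \<inter> \<Omega> \<and> \<gamma> \<zeta> = \<phi> u \<and> inv_into U \<phi> (\<gamma> \<zeta>) = u" if "\<zeta> \<in> ball 0 1" for \<zeta>
  proof -
    have "\<gamma> \<zeta> \<in> \<phi> ` (U \<inter> \<Omega>)"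
      using sub imageI[OF that] by (rule subsetD)
    then show ?thesis
      using inv by (metis IntD1 imageE)
  qed
  show "(inv_into U \<phi> \<circ> \<gamma>) ` ball 0 1 \<subseteq> \<Omega>"
  proof (rule image_subsetI)
    show "(inv_into U \<phi> \<circ> \<gamma>) \<zeta> \<in> \<Omega>" if "\<zeta> \<in> ball 0 1" for \<zeta>
      using lift[OF that] by auto
  qed
  have "continuous_on (ball 0 1) (\<lambda>\<zeta>. \<chi> j. \<gamma> \<zeta> $ j)"
    by (intro continuous_intros holomorphic_on_imp_continuous_on \<gamma>)
  then have "continuous_on (ball 0 1) \<gamma>"
    by (simp only: vec_lambda_eta)
  then show cont: "continuous_on (ball 0 1) (inv_into U \<phi> \<circ> \<gamma>)"
    by (rule continuous_on_compose[OF _ continuous_on_subset[OF homeomorphism_cont2[OF hom] sub']])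
  have "(\<lambda>\<zeta>. \<psi> ((inv_into U \<phi> \<circ> \<gamma>) \<zeta>) $ i) holomorphic_on (ball 0 1 \<inter> (inv_into U \<phi> \<circ> \<gamma>) -` V)"
    if V: "(V, \<psi>) \<in> A" for V \<psi> i
  proof -
    let ?T = "ball 0 1 \<inter> (inv_into U \<phi> \<circ> \<gamma>) -` V"
    have "open ?T"
      using continuous_open_preimage[OF cont] chart_open[OF assms(1) V] by blast
    moreover have "\<gamma> ` ?T \<subseteq> \<phi> ` (U \<inter> V)"
    proof (rule image_subsetI)
      fix \<zeta> assume "\<zeta> \<in> ?T"
      then show "\<gamma> \<zeta> \<in> \<phi> ` (U \<inter> V)"
        using lift[of \<zeta>] by auto
    qed
    moreover have "(\<lambda>\<zeta>. \<gamma> \<zeta> $ j) holomorphic_on ?T" for j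
      using \<gamma> by (rule holomorphic_on_subset) auto
    ultimately have "(\<lambda>\<zeta>. (\<psi> \<circ> inv_into U \<phi>) (\<gamma> \<zeta>) $ i) holomorphic_on ?T"
      using cvec_holomorphic_compose[OF chart_transition[OF assms(1,2) V]] by blast
    then show ?thesis
      by (simp add: o_def)
  qed
  then show "\<forall>(V, \<psi>)\<in>A. \<forall>i. (\<lambda>\<zeta>. \<psi> ((inv_into U \<phi> \<circ> \<gamma>) \<zeta>) $ i) holomorphic_on
      (ball 0 1 \<inter> (inv_into U \<phi> \<circ> \<gamma>) -` V)"
    by blast
qed

text \<open>All later local arguments go through one parametrisation \<open>\<iota>\<close> of a neighbourhood of \<open>z\<close> by a closed
  ball: it supplies compact neighbourhoods, open neighbourhoods, and the affine discs through \<open>z\<close>.\<close>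

lemma chart_ball:
  assumes "complex_manifold A" "open W" "z \<in> W" "W \<subseteq> \<Omega>"
  obtains \<iota> :: "complex^'n \<Rightarrow> 'x::{t2_space, second_countable_topology}" and c r
  where "r > 0" "\<iota> c = z" "continuous_on (cball c r) \<iota>" "\<iota> ` cball c r \<subseteq> W"
    "\<And>s. s \<le> r \<Longrightarrow> open (\<iota> ` ball c s)"
    "\<And>v. norm v \<le> r \<Longrightarrow> holomorphic_disc (A :: ('x, 'n::finite) atlas) \<Omega> (\<lambda>\<zeta>. \<iota> (c + \<zeta> *s v))"
proof -
  obtain U \<phi> where U: "(U, \<phi>) \<in> A" "z \<in> U"
    using complex_manifold_chart_at[OF assms(1)] .
  note hom = chart_homeomorphism[OF assms(1) U(1)]
  define \<iota> where "\<iota> = inv_into U \<phi>"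
  have inv: "\<iota> (\<phi> x) = x" if "x \<in> U" for x
    unfolding \<iota>_def using homeomorphism_apply1[OF hom that] .
  have "openin (top_of_set (\<phi> ` U)) (\<phi> ` (U \<inter> W))"
    using homeomorphism_imp_open_map[OF hom] assms(2) by blast
  then have "open (\<phi> ` (U \<inter> W))"
    using chart_open_image[OF assms(1) U(1)] openin_open_trans by blast
  then obtain r where r: "r > 0" "cball (\<phi> z) r \<subseteq> \<phi> ` (U \<inter> W)"
    using open_contains_cball U(2) assms(3) by blast
  have lift: "\<exists>u. u \<in> U \<inter> W \<and> x = \<phi> u \<and> \<iota> x = u" if "x \<in> cball (\<phi> z) r" for x
    using subsetD[OF r(2) that] inv by (metis IntD1 imageE)
  have rU: "cball (\<phi> z) r \<subseteq> \<phi> ` U"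
    using r(2) by (rule order_trans) (rule image_mono, rule Int_lower1)
  show ?thesis
  proof (rule that[of r \<iota> "\<phi> z"])
    show "\<iota> ` cball (\<phi> z) r \<subseteq> W"
      using lift by (intro image_subsetI) blast
    show "continuous_on (cball (\<phi> z) r) \<iota>"
      unfolding \<iota>_def by (rule continuous_on_subset[OF homeomorphism_cont2[OF hom] rU])
    show "open (\<iota> ` ball (\<phi> z) s)" if "s \<le> r" for s
    proof -
      have "\<iota> ` ball (\<phi> z) s = U \<inter> \<phi> -` ball (\<phi> z) s"
      proof
        show "\<iota> ` ball (\<phi> z) s \<subseteq> U \<inter> \<phi> -` ball (\<phi> z) s"
        proof (rule image_subsetI)
          fix x assume x: "x \<in> ball (\<phi> z) s"
          then have "x \<in> cball (\<phi> z) r"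
            using that by simp
          from lift[OF this] x show "\<iota> x \<in> U \<inter> \<phi> -` ball (\<phi> z) s"
            by auto
        qed
        show "U \<inter> \<phi> -` ball (\<phi> z) s \<subseteq> \<iota> ` ball (\<phi> z) s"
        proof
          fix u assume "u \<in> U \<inter> \<phi> -` ball (\<phi> z) s"
          then show "u \<in> \<iota> ` ball (\<phi> z) s"
            using inv[of u] by (intro image_eqI[of _ _ "\<phi> u"]) auto
        qed
      qed
      then show ?thesis
        using continuous_open_preimage[OF homeomorphism_cont1[OF hom]] chart_open[OF assms(1) U(1)]
        by simp
    qed
    show "holomorphic_disc A \<Omega> (\<lambda>\<zeta>. \<iota> (\<phi> z + \<zeta> *s v))" if "norm v \<le> r" for v
    proof -
      have "(\<lambda>\<zeta>. \<phi> z + \<zeta> *s v) ` ball 0 1 \<subseteq> cball (\<phi> z) r"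
      proof (rule image_subsetI)
        fix \<zeta> :: complex assume "\<zeta> \<in> ball 0 1"
        then have "cmod \<zeta> * norm v \<le> 1 * norm v"
          by (intro mult_right_mono) auto
        then show "\<phi> z + \<zeta> *s v \<in> cball (\<phi> z) r"
          using that by (simp add: dist_norm cvec_norm_scale)
      qed
      also note r(2)
      also have "\<phi> ` (U \<inter> W) \<subseteq> \<phi> ` (U \<inter> \<Omega>)"
        using assms(4) by (intro image_mono Int_mono order_refl)
      finally have "(\<lambda>\<zeta>. \<phi> z + \<zeta> *s v) ` ball 0 1 \<subseteq> \<phi> ` (U \<inter> \<Omega>)" .
      moreover have "(\<lambda>\<zeta>. (\<phi> z + \<zeta> *s v) $ j) holomorphic_on ball 0 1" for j
        by (simp, intro holomorphic_intros)
      ultimately show ?thesis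
        using holomorphic_disc_in_chart[OF assms(1) U(1), of "\<lambda>\<zeta>. \<phi> z + \<zeta> *s v" \<Omega>]
        unfolding \<iota>_def o_def by blast
    qed
  qed (use r U inv in auto)
qed

section \<open>Chains of discs and the Kobayashi distance\<close>

lemma poincare_dist_arg_less_1:
  assumes "a \<in> ball 0 1" "b \<in> ball 0 1"
  shows "cmod ((a - b) / (1 - cnj b * a)) < 1"
  using Moebius_function_norm_lt_1[of b a 0] assms by (simp add: Moebius_function_simple)

lemma artanh_nonneg:
  assumes "0 \<le> (x::real)" "x < 1"
  shows "0 \<le> artanh x"
  using assms by (simp add: artanh_def field_simps)

lemma poincare_dist_nonneg:
  assumes "a \<in> ball 0 1" "b \<in> ball 0 1"
  shows "0 \<le> poincare_dist a b"
  unfolding poincare_dist_def using poincare_dist_arg_less_1[OF assms] by (simp add: artanh_nonneg)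

text \<open>With \<open>s\<close> and \<open>t\<close> as Euclidean distances from the centre of the disc, this says that radii are
  geodesics for the Poincare distance.\<close>

lemma artanh_split:
  assumes "0 \<le> (s::real)" "s \<le> t" "t < 1"
  shows "artanh s + artanh ((t - s) / (1 - s * t)) = artanh t"
proof -
  have "s * t < 1"
    using assms by (meson le_less_trans mult_left_le less_imp_le order_trans)
  then have u: "1 + (t - s) / (1 - s * t) = (1 - s) * (1 + t) / (1 - s * t)"
    "1 - (t - s) / (1 - s * t) = (1 - t) * (1 + s) / (1 - s * t)"
    by (simp_all add: field_simps)
  have "(1 + s) / (1 - s) * ((1 + (t - s) / (1 - s * t)) / (1 - (t - s) / (1 - s * t))) = (1 + t) / (1 - t)"
    unfolding u using assms \<open>s * t < 1\<close> by (simp add: divide_simps)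
  moreover have "(1 + s) / (1 - s) > 0" "(1 + (t - s) / (1 - s * t)) / (1 - (t - s) / (1 - s * t)) > 0"
    unfolding u using assms \<open>s * t < 1\<close> by (auto intro!: divide_pos_pos mult_pos_pos)
  ultimately show ?thesis
    unfolding artanh_def by (simp add: add_divide_distrib flip: ln_mult_pos)
qed

lemma poincare_dist_along_radius:
  assumes "b \<in> ball 0 1" "0 \<le> s" "s \<le> 1"
  shows "poincare_dist 0 (of_real s * b) + poincare_dist (of_real s * b) b = poincare_dist 0 b"
proof -
  let ?t = "cmod b"
  have t: "?t < 1"
    using assms(1) by simp
  have st: "0 \<le> s * ?t" "s * ?t \<le> ?t"
    using assms by (simp_all add: mult_left_le_one_le)
  have eq: "(of_real s * b - b) = - (of_real (1 - s) * b)"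
    by (simp add: algebra_simps)
  have num: "cmod (of_real s * b - b) = ?t - s * ?t"
    using assms(3) unfolding eq norm_minus_cancel norm_mult norm_of_real
    by (simp add: algebra_simps)
  have "1 - cnj b * (of_real s * b) = of_real (1 - s * ?t * ?t)"
    using complex_norm_square[of b] by (simp add: algebra_simps power2_eq_square)
  moreover have "s * ?t * ?t \<le> 1"
    using st t by (meson le_less_trans less_imp_le mult_left_le order_trans norm_ge_zero)
  ultimately have den: "cmod (1 - cnj b * (of_real s * b)) = 1 - s * ?t * ?t"
    by (metis abs_of_nonneg diff_ge_0_iff_ge norm_of_real)
  have "cmod (of_real s * b) = s * ?t"
    using assms(2) by (simp add: norm_mult)
  then have "poincare_dist 0 (of_real s * b) = artanh (s * ?t)"
    unfolding poincare_dist_def by simp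
  moreover have "poincare_dist 0 b = artanh ?t"
    unfolding poincare_dist_def by simp
  moreover have "poincare_dist (of_real s * b) b = artanh ((?t - s * ?t) / (1 - s * ?t * ?t))"
    unfolding poincare_dist_def norm_divide num den ..
  ultimately show ?thesis
    using artanh_split[OF st t] by simp
qed

text \<open>A disc automorphism moves \<open>a\<close> to the centre, so that the geodesic to the second point becomes a
  Euclidean segment.\<close>

lemma holomorphic_disc_recentre:
  assumes g: "holomorphic_disc A \<Omega> g" and a: "a \<in> ball 0 1" and b: "b \<in> ball 0 1"
  obtains h b' where "holomorphic_disc A \<Omega> h" "b' \<in> ball 0 1" "h 0 = g a" "h b' = g b"
    "poincare_dist 0 b' = poincare_dist a b"
proof -
  let ?m = "Moebius_function 0 (-a)" and ?b' = "Moebius_function 0 a b"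
  have na: "norm (-a) < 1" "norm a < 1" and nb: "norm b < 1"
    using a b by auto
  have "holomorphic_disc A \<Omega> (g \<circ> ?m)"
    using Moebius_function_norm_lt_1[OF na(1)]
    by (intro holomorphic_disc_reparametrise[OF g] Moebius_function_holomorphic na) auto
  moreover have "?b' \<in> ball 0 1"
    using Moebius_function_norm_lt_1[OF na(2) nb] by simp
  moreover have "(g \<circ> ?m) 0 = g a"
    by (simp add: Moebius_function_of_zero)
  moreover have "(g \<circ> ?m) ?b' = g b"
    using Moebius_function_compose[of "-a" a b] na nb by simp
  moreover have "poincare_dist 0 ?b' = poincare_dist a b"
  proof -
    have "cmod (1 - cnj a * b) = cmod (1 - cnj b * a)"
      using complex_mod_cnj[of "1 - cnj a * b"] by (simp add: mult.commute)
    then show ?thesis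
      unfolding poincare_dist_def Moebius_function_simple
      by (simp add: norm_divide norm_minus_commute)
  qed
  ultimately show ?thesis
    by (rule that)
qed

lemma disc_chain_sum_nonneg:
  assumes "disc_chain A \<Omega> z w m g a b"
  shows "0 \<le> (\<Sum>i<m. poincare_dist (a i) (b i))"
  using assms poincare_dist_nonneg unfolding disc_chain_def by (intro sum_nonneg) auto

lemma kobayashi_le_chain:
  assumes "z \<in> \<Omega>" "w \<in> \<Omega>" "disc_chain A \<Omega> z w m g a b"
  shows "kobayashi A \<Omega> z w \<le> (\<Sum>i<m. poincare_dist (a i) (b i))"
proof -
  have "bdd_below {\<Sum>i<m. poincare_dist (a i) (b i) | m g a b. disc_chain A \<Omega> z w m g a b}"
    using disc_chain_sum_nonneg by (intro bdd_belowI[of _ 0]) blast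
  then show ?thesis
    unfolding kobayashi_def using assms by (auto intro!: cInf_lower)
qed

lemma kobayashi_le_disc:
  assumes "holomorphic_disc A \<Omega> g" "a \<in> ball 0 1" "b \<in> ball 0 1"
  shows "kobayashi A \<Omega> (g a) (g b) \<le> poincare_dist a b"
proof -
  have "disc_chain A \<Omega> (g a) (g b) 1 (\<lambda>_. g) (\<lambda>_. a) (\<lambda>_. b)"
    unfolding disc_chain_def using assms by (intro exI[of _ "\<lambda>i. if i = 0 then g a else g b"]) auto
  moreover have "g a \<in> \<Omega>" "g b \<in> \<Omega>"
    using assms unfolding holomorphic_disc_def by auto
  ultimately show ?thesis
    using kobayashi_le_chain by fastforce
qed

lemma disc_chain_snoc:
  assumes "disc_chain A \<Omega> z (h \<alpha>) m g a b" "holomorphic_disc A \<Omega> h" "\<alpha> \<in> ball 0 1" "\<beta> \<in> ball 0 1"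
  shows "disc_chain A \<Omega> z (h \<beta>) (Suc m) (g(m := h)) (a(m := \<alpha>)) (b(m := \<beta>))"
proof -
  obtain c where "c 0 = z" "c m = h \<alpha>" "\<forall>i<m. holomorphic_disc A \<Omega> (g i) \<and> a i \<in> ball 0 1 \<and> b i \<in> ball 0 1 \<and>
              g i (a i) = c i \<and> g i (b i) = c (Suc i)"
    using assms(1) unfolding disc_chain_def by blast
  then show ?thesis
    unfolding disc_chain_def using assms(2-)
    by (intro exI[of _ "c(Suc m := h \<beta>)"]) (auto simp: less_Suc_eq)
qed

text \<open>In a chart, fix \<open>t\<close> of small Poincare size.  The affine disc through \<open>z\<close> that reaches \<open>w\<close> at parameter
  \<open>t\<close> has velocity \<open>1/t\<close> times the coordinate difference, and so stays in the chart ball if \<open>w\<close> is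
  close to \<open>z\<close>.\<close>

lemma small_discs_near:
  fixes A :: "('x::{t2_space, second_countable_topology}, 'n::finite) atlas"
  assumes "complex_manifold A" "open \<Omega>" "z \<in> \<Omega>" "\<epsilon> > 0"
  obtains V where "open V" "z \<in> V" "V \<subseteq> \<Omega>"
    "\<And>w. w \<in> V \<Longrightarrow> \<exists>g b. holomorphic_disc A \<Omega> g \<and> b \<in> ball 0 1 \<and> g 0 = z \<and> g b = w \<and> poincare_dist 0 b < \<epsilon>"
proof -
  obtain \<iota> :: "complex^'n \<Rightarrow> 'x" and c r
    where r: "r > 0" "\<iota> c = z" "\<iota> ` cball c r \<subseteq> \<Omega>" "\<And>s. s \<le> r \<Longrightarrow> open (\<iota> ` ball c s)"
    "\<And>v. norm v \<le> r \<Longrightarrow> holomorphic_disc A \<Omega> (\<lambda>\<zeta>. \<iota> (c + \<zeta> *s v))"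
    using chart_ball[OF assms(1-3) order_refl] by metis
  have "(artanh \<longlongrightarrow> artanh 0) (at_right (0::real))"
    by (rule tendsto_within_subset[OF isCont_artanh[unfolded isCont_def]]) auto
  then have "\<forall>\<^sub>F t in at_right (0::real). artanh t < \<epsilon>"
    using \<open>\<epsilon> > 0\<close> by (intro order_tendstoD(2)[of _ 0]) auto
  moreover have "\<forall>\<^sub>F t in at_right (0::real). t < 1"
    by (intro eventually_at_rightI[of 0 1]) auto
  moreover have "\<forall>\<^sub>F t in at_right (0::real). 0 < t"
    by (intro eventually_at_rightI[of 0 1]) auto
  ultimately have "\<forall>\<^sub>F t in at_right (0::real). 0 < t \<and> t < 1 \<and> artanh t < \<epsilon>"
    by eventually_elim auto
  then obtain t :: real where t: "0 < t" "t < 1" "artanh t < \<epsilon>"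
    using eventually_happens' trivial_limit_at_right_real by blast
  show ?thesis
  proof (rule that[of "\<iota> ` ball c (r * t)"])
    have rt: "r * t \<le> r"
      using r(1) t by (simp add: mult_left_le)
    then show "open (\<iota> ` ball c (r * t))"
      by (rule r(4))
    show "z \<in> \<iota> ` ball c (r * t)"
      using r(1,2) t(1) by (intro image_eqI[of _ _ c]) auto
    show "\<iota> ` ball c (r * t) \<subseteq> \<Omega>"
      using r(3) rt subset_ball[OF rt, of c] ball_subset_cball[of c r] by blast
    fix w assume "w \<in> \<iota> ` ball c (r * t)"
    then obtain c' where c': "w = \<iota> c'" "dist c c' < r * t"
      by auto
    define v where "v = inverse (of_real t :: complex) *s (c' - c)"
    have "norm v = norm (c' - c) / t"
      unfolding v_def cvec_norm_scale using t(1) by (simp add: norm_inverse divide_inverse mult.commute)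
    also have "\<dots> \<le> r"
      using c'(2) t(1) by (simp add: dist_norm norm_minus_commute divide_simps)
    finally have "holomorphic_disc A \<Omega> (\<lambda>\<zeta>. \<iota> (c + \<zeta> *s v))"
      by (rule r(5))
    moreover have "c + of_real t *s v = c'"
      unfolding v_def using t(1) by (simp add: vector_smult_assoc)
    moreover have "poincare_dist 0 (of_real t) < \<epsilon>"
      unfolding poincare_dist_def using t by simp
    ultimately show "\<exists>g b. holomorphic_disc A \<Omega> g \<and> b \<in> ball 0 1 \<and> g 0 = z \<and> g b = w \<and> poincare_dist 0 b < \<epsilon>"
      using t r(2) c'(1)
      by (intro exI[of _ "\<lambda>\<zeta>. \<iota> (c + \<zeta> *s v)"] exI[of _ "of_real t"]) auto
  qed
qed

text \<open>Being joined by a chain is an equivalence relation with open classes, and \<open>\<Omega>\<close> is connected.\<close>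

lemma disc_chain_exists:
  fixes A :: "('x::{t2_space, second_countable_topology}, 'n::finite) atlas"
  assumes "complex_manifold A" "open \<Omega>" "connected \<Omega>" "z \<in> \<Omega>" "w \<in> \<Omega>"
  shows "\<exists>m g a b. disc_chain A \<Omega> z w m g a b"
proof -
  define R where "R x y \<longleftrightarrow> (\<exists>g a b. holomorphic_disc A \<Omega> g \<and> a \<in> ball 0 1 \<and> b \<in> ball 0 1 \<and> g a = x \<and> g b = y)"
    for x y
  have "R\<^sup>*\<^sup>* z w"
  proof (rule connected_equivalence_relation[OF assms(3,4,5)])
    have "R\<inverse>\<inverse> = R"
      unfolding R_def by (intro ext) blast
    then show "R\<^sup>*\<^sup>* y x" if "R\<^sup>*\<^sup>* x y" for x y
      using that by (metis conversep_iff rtranclp_conversep)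
    show "R\<^sup>*\<^sup>* x z" if "R\<^sup>*\<^sup>* x y" "R\<^sup>*\<^sup>* y z" for x y z
      using that by simp
    fix x assume "x \<in> \<Omega>"
    then obtain V where V: "open V" "x \<in> V" "V \<subseteq> \<Omega>"
      "\<And>y. y \<in> V \<Longrightarrow> \<exists>g b. holomorphic_disc A \<Omega> g \<and> b \<in> ball 0 1 \<and> g 0 = x \<and> g b = y \<and> poincare_dist 0 b < 1"
      using small_discs_near[OF assms(1,2) _ zero_less_one] by metis
    have "R x y" if y: "y \<in> V" for y
    proof -
      obtain g b where "holomorphic_disc A \<Omega> g" "b \<in> ball 0 1" "g 0 = x" "g b = y"
        using V(4)[OF y] by blast
      then show ?thesis
        unfolding R_def by (intro exI[of _ g] exI[of _ 0] exI[of _ b]) simp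
    qed
    then show "\<exists>T. openin (top_of_set \<Omega>) T \<and> x \<in> T \<and> (\<forall>y\<in>T. R\<^sup>*\<^sup>* x y)"
      using V assms(2) by (intro exI[of _ V]) (auto simp: openin_open_eq)
  qed
  then show ?thesis
  proof (induction rule: rtranclp_induct)
    case base
    have "disc_chain A \<Omega> z z 0 g a b" for g a b
      unfolding disc_chain_def by (intro exI[of _ "\<lambda>_. z"]) simp
    then show ?case
      by blast
  next
    case (step x y)
    then obtain h \<alpha> \<beta> where "holomorphic_disc A \<Omega> h" "\<alpha> \<in> ball 0 1" "\<beta> \<in> ball 0 1" "h \<alpha> = x" "h \<beta> = y"
      unfolding R_def by blast
    then show ?case
      using step.IH disc_chain_snoc[of A \<Omega> z h \<alpha>] by blast
  qed
qed

lemma kobayashi_near_optimal_chain: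
  fixes A :: "('x::{t2_space, second_countable_topology}, 'n::finite) atlas"
  assumes "complex_manifold A" "open \<Omega>" "connected \<Omega>" "z \<in> \<Omega>" "w \<in> \<Omega>" "\<epsilon> > 0"
  obtains m g a b where "disc_chain A \<Omega> z w m g a b"
    "(\<Sum>i<m. poincare_dist (a i) (b i)) < kobayashi A \<Omega> z w + \<epsilon>"
proof -
  let ?S = "{\<Sum>i<m. poincare_dist (a i) (b i) | m g a b. disc_chain A \<Omega> z w m g a b}"
  have "?S \<noteq> {}"
    using disc_chain_exists[OF assms(1-5)] by blast
  moreover have "Inf ?S < kobayashi A \<Omega> z w + \<epsilon>"
    unfolding kobayashi_def using assms by simp
  ultimately have "\<exists>x\<in>?S. x < kobayashi A \<Omega> z w + \<epsilon>"
    by (rule cInf_lessD)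
  then show ?thesis
    using that by blast
qed

text \<open>Composing the discs of a chain with \<open>f\<close> gives a chain with the same parameters.\<close>

lemma kobayashi_self_map_le:
  fixes A :: "('x::{t2_space, second_countable_topology}, 'n::finite) atlas"
  assumes "complex_manifold A" "open \<Omega>" "connected \<Omega>" "holomorphic_self_map A \<Omega> f" "z \<in> \<Omega>" "w \<in> \<Omega>"
  shows "kobayashi A \<Omega> (f z) (f w) \<le> kobayashi A \<Omega> z w"
proof (rule field_le_epsilon)
  fix \<epsilon> :: real
  assume "\<epsilon> > 0"
  then obtain m g a b where chain: "disc_chain A \<Omega> z w m g a b"
    "(\<Sum>i<m. poincare_dist (a i) (b i)) < kobayashi A \<Omega> z w + \<epsilon>"
    using kobayashi_near_optimal_chain[OF assms(1-3,5,6)] by metis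
  then obtain c where "c 0 = z" "c m = w" "\<forall>i<m. holomorphic_disc A \<Omega> (g i) \<and> a i \<in> ball 0 1 \<and>
      b i \<in> ball 0 1 \<and> g i (a i) = c i \<and> g i (b i) = c (Suc i)"
    unfolding disc_chain_def by blast
  then have "disc_chain A \<Omega> (f z) (f w) m (\<lambda>i. f \<circ> g i) a b"
    unfolding disc_chain_def using holomorphic_disc_compose_self_map[OF assms(1) _ assms(4)]
    by (intro exI[of _ "f \<circ> c"]) simp
  moreover have "f z \<in> \<Omega>" "f w \<in> \<Omega>"
    using assms(4-6) unfolding holomorphic_self_map_def by auto
  ultimately show "kobayashi A \<Omega> (f z) (f w) \<le> kobayashi A \<Omega> z w + \<epsilon>"
    using kobayashi_le_chain chain(2) by fastforce
qed

section \<open>The Kobayashi distance is an inner metric\<close>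

text \<open>The connected set is the image of the Poincare geodesic between the two parameters.\<close>

lemma disc_arc:
  assumes g: "holomorphic_disc A \<Omega> g" "a \<in> ball 0 1" "b \<in> ball 0 1"
  shows "\<exists>S. connected S \<and> S \<subseteq> \<Omega> \<and> g a \<in> S \<and> g b \<in> S \<and>
    (\<forall>u\<in>S. kobayashi A \<Omega> (g a) u + kobayashi A \<Omega> u (g b) \<le> poincare_dist a b)"
proof -
  obtain h b' where h: "holomorphic_disc A \<Omega> h" "b' \<in> ball 0 1" "h 0 = g a" "h b' = g b"
    "poincare_dist 0 b' = poincare_dist a b"
    using holomorphic_disc_recentre[OF g] .
  define I where "I = (\<lambda>s::real. of_real s * b') ` {0..1}"
  have I: "I \<subseteq> ball 0 1"
  proof -
    have "cmod (of_real s * b') \<le> cmod b'" if "s \<in> {0..1}" for s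
      using that by (simp add: norm_mult mult_left_le_one_le)
    then show ?thesis
      unfolding I_def using h(2) by (fastforce intro: le_less_trans)
  qed
  have "connected I"
    unfolding I_def by (intro connected_continuous_image continuous_intros) auto
  moreover have "continuous_on I h"
    using h(1) I continuous_on_subset unfolding holomorphic_disc_def by metis
  ultimately have "connected (h ` I)"
    by (rule connected_continuous_image[rotated])
  moreover have "h ` I \<subseteq> \<Omega>"
    using h(1) I unfolding holomorphic_disc_def by (meson image_mono order_trans)
  moreover have "g a \<in> h ` I" "g b \<in> h ` I"
    unfolding I_def h(3,4)[symmetric] by (force intro: image_eqI[of _ _ 0] image_eqI[of _ _ 1])+
  moreover have "kobayashi A \<Omega> (g a) u + kobayashi A \<Omega> u (g b) \<le> poincare_dist a b" if u: "u \<in> h ` I" for u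
  proof -
    obtain s :: real where s: "u = h (of_real s * b')" "0 \<le> s" "s \<le> 1"
      using u unfolding I_def by auto
    then have "of_real s * b' \<in> I"
      unfolding I_def by auto
    then have "of_real s * b' \<in> ball 0 1"
      using I by blast
    then have "kobayashi A \<Omega> (h 0) u \<le> poincare_dist 0 (of_real s * b')"
      "kobayashi A \<Omega> u (h b') \<le> poincare_dist (of_real s * b') b'"
      unfolding s(1) using h(1,2) by (intro kobayashi_le_disc; simp)+
    then show ?thesis
      using poincare_dist_along_radius[OF h(2) s(2,3)] h(3-5) by simp
  qed
  ultimately show ?thesis
    by (intro exI[of _ "h ` I"]) simp
qed

lemma chain_arc:
  assumes "Metric_space \<Omega> (kobayashi A \<Omega>)" "z \<in> \<Omega>" "disc_chain A \<Omega> z w m g a b"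
  shows "\<exists>S. connected S \<and> S \<subseteq> \<Omega> \<and> z \<in> S \<and> w \<in> S \<and>
    (\<forall>u\<in>S. kobayashi A \<Omega> z u + kobayashi A \<Omega> u w \<le> (\<Sum>i<m. poincare_dist (a i) (b i)))"
  using assms(3)
proof (induction m arbitrary: w)
  case 0
  then have "w = z"
    unfolding disc_chain_def by auto
  then show ?case
    using assms(2) Metric_space.mdist_zero[OF assms(1)] by (intro exI[of _ "{z}"]) simp
next
  case (Suc m)
  let ?k = "kobayashi A \<Omega>"
  note triangle = Metric_space.triangle[OF assms(1)]
  obtain c where c: "c 0 = z" "c (Suc m) = w" "\<forall>i<Suc m. holomorphic_disc A \<Omega> (g i) \<and>
      a i \<in> ball 0 1 \<and> b i \<in> ball 0 1 \<and> g i (a i) = c i \<and> g i (b i) = c (Suc i)"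
    using Suc.prems unfolding disc_chain_def by blast
  then have disc: "holomorphic_disc A \<Omega> (g m)" "a m \<in> ball 0 1" "b m \<in> ball 0 1"
    "g m (a m) = c m" "g m (b m) = w"
    by auto
  have "disc_chain A \<Omega> z (c m) m g a b"
    unfolding disc_chain_def using c by (intro exI[of _ c]) simp
  then obtain S where S: "connected S" "S \<subseteq> \<Omega>" "z \<in> S" "c m \<in> S"
    "\<And>u. u \<in> S \<Longrightarrow> ?k z u + ?k u (c m) \<le> (\<Sum>i<m. poincare_dist (a i) (b i))"
    using Suc.IH by blast
  obtain T where T: "connected T" "T \<subseteq> \<Omega>" "c m \<in> T" "w \<in> T"
    "\<And>u. u \<in> T \<Longrightarrow> ?k (c m) u + ?k u w \<le> poincare_dist (a m) (b m)"
    using disc_arc[OF disc(1-3)] disc(4,5) by auto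
  have "?k z u + ?k u w \<le> (\<Sum>i<Suc m. poincare_dist (a i) (b i))" if "u \<in> S \<union> T" for u
  proof -
    have "z \<in> \<Omega>" "c m \<in> \<Omega>" "w \<in> \<Omega>" "u \<in> \<Omega>"
      using S T that by auto
    then have "?k u w \<le> ?k u (c m) + ?k (c m) w" "?k z u \<le> ?k z (c m) + ?k (c m) u"
      using triangle by blast+
    moreover have "?k (c m) w \<le> poincare_dist (a m) (b m)" "?k z (c m) \<le> (\<Sum>i<m. poincare_dist (a i) (b i))"
      using S(5)[OF S(4)] T(5)[OF T(3)] Metric_space.nonneg[OF assms(1)]
      by (meson add_increasing2 add_increasing order_trans le_add_same_cancel1 le_add_same_cancel2)+
    ultimately show ?thesis
      using that S(5)[of u] T(5)[of u] by auto
  qed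
  moreover have "connected (S \<union> T)"
    using S T by (intro connected_Un) auto
  ultimately show ?case
    using S T by (intro exI[of _ "S \<union> T"]) auto
qed

lemma kobayashi_near_geodesic:
  fixes A :: "('x::{t2_space, second_countable_topology}, 'n::finite) atlas"
  assumes "complex_manifold A" "open \<Omega>" "connected \<Omega>" "Metric_space \<Omega> (kobayashi A \<Omega>)"
    and "z \<in> \<Omega>" "w \<in> \<Omega>" "\<epsilon> > 0"
  shows "\<exists>S. connected S \<and> S \<subseteq> \<Omega> \<and> z \<in> S \<and> w \<in> S \<and>
    (\<forall>u\<in>S. kobayashi A \<Omega> z u + kobayashi A \<Omega> u w < kobayashi A \<Omega> z w + \<epsilon>)"
proof -
  obtain m g a b where chain: "disc_chain A \<Omega> z w m g a b"
    and less: "(\<Sum>i<m. poincare_dist (a i) (b i)) < kobayashi A \<Omega> z w + \<epsilon>"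
    using kobayashi_near_optimal_chain[OF assms(1-3,5-7)] .
  obtain S where "connected S" "S \<subseteq> \<Omega>" "z \<in> S" "w \<in> S"
    "\<forall>u\<in>S. kobayashi A \<Omega> z u + kobayashi A \<Omega> u w \<le> (\<Sum>i<m. poincare_dist (a i) (b i))"
    using chain_arc[OF assms(4,5) chain] by blast
  then show ?thesis
    using less by (intro exI[of _ S]) (auto intro: order_le_less_trans)
qed

lemma kobayashi_ball_open_nbhd:
  fixes A :: "('x::{t2_space, second_countable_topology}, 'n::finite) atlas"
  assumes "complex_manifold A" "open \<Omega>" "Metric_space \<Omega> (kobayashi A \<Omega>)" "z \<in> \<Omega>" "\<epsilon> > 0"
  obtains V where "open V" "z \<in> V" "V \<subseteq> Metric_space.mball \<Omega> (kobayashi A \<Omega>) z \<epsilon>"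
proof -
  interpret Metric_space \<Omega> "kobayashi A \<Omega>"
    by (rule assms(3))
  obtain V where V: "open V" "z \<in> V" "V \<subseteq> \<Omega>"
    "\<And>w. w \<in> V \<Longrightarrow> \<exists>g b. holomorphic_disc A \<Omega> g \<and> b \<in> ball 0 1 \<and> g 0 = z \<and> g b = w \<and> poincare_dist 0 b < \<epsilon>"
    using small_discs_near[OF assms(1,2,4,5)] by metis
  have "w \<in> mball z \<epsilon>" if w: "w \<in> V" for w
  proof -
    obtain g b where "holomorphic_disc A \<Omega> g" "b \<in> ball 0 1" "g 0 = z" "g b = w" "poincare_dist 0 b < \<epsilon>"
      using V(4)[OF w] by blast
    then have "kobayashi A \<Omega> z w < \<epsilon>"
      using kobayashi_le_disc[of A \<Omega> g 0 b] by simp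
    then show ?thesis
      using w V(3) assms(4) by auto
  qed
  then show ?thesis
    using that V by blast
qed

text \<open>Barth's argument: points close to \<open>z\<close> are joined to \<open>z\<close> by connected sets that stay close to \<open>z\<close>, and
  these cannot leave a compact coordinate neighbourhood, since \<open>k z\<close> is bounded below by a positive
  constant on its boundary.\<close>

lemma kobayashi_ball_small:
  fixes A :: "('x::{t2_space, second_countable_topology}, 'n::finite) atlas"
  assumes "complex_manifold A" "open \<Omega>" "connected \<Omega>" "Metric_space \<Omega> (kobayashi A \<Omega>)"
    and "open W" "z \<in> W" "W \<subseteq> \<Omega>"
  obtains C \<epsilon> where "compact C" "C \<subseteq> W" "\<epsilon> > 0" "Metric_space.mball \<Omega> (kobayashi A \<Omega>) z \<epsilon> \<subseteq> C"
proof -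
  let ?k = "kobayashi A \<Omega>"
  interpret Metric_space \<Omega> ?k
    by (rule assms(4))
  have z: "z \<in> \<Omega>"
    using assms(6,7) by blast
  obtain \<iota> :: "complex^'n \<Rightarrow> 'x" and c r
    where r: "r > 0" "\<iota> c = z" "continuous_on (cball c r) \<iota>" "\<iota> ` cball c r \<subseteq> W" "\<And>s. s \<le> r \<Longrightarrow> open (\<iota> ` ball c s)"
    using chart_ball[OF assms(1,5-7)] by metis
  define C where "C = \<iota> ` cball c r"
  define V where "V = \<iota> ` ball c r"
  have "compact C"
    unfolding C_def using r(3) by (intro compact_continuous_image) auto
  have V: "open V" "z \<in> V" "V \<subseteq> C"
    unfolding V_def C_def using r(1,2) r(5)[of r] by (auto intro: image_eqI[of _ _ c])
  have "frontier V \<subseteq> C"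
    using V(3) closure_minimal compact_imp_closed[OF \<open>compact C\<close>] unfolding frontier_def by blast
  then have F: "compact (frontier V)" "frontier V \<subseteq> \<Omega>" "z \<notin> frontier V"
    using compact_Int_closed[OF \<open>compact C\<close> frontier_closed, of V] r(4) assms(7) V(1,2)
    unfolding C_def by (auto simp: Int_absorb1 frontier_def interior_open)
  have cont: "continuous_on (frontier V) (?k z)"
    unfolding continuous_on
  proof (intro ballI tendstoI)
    fix x and e :: real
    assume x: "x \<in> frontier V" and "e > 0"
    then obtain U where U: "open U" "x \<in> U" "U \<subseteq> mball x e"
      using kobayashi_ball_open_nbhd[OF assms(1,2,4)] F(2) by (metis subsetD)
    have "dist (?k z y) (?k z x) < e" if "y \<in> U" for y
    proof -
      have y: "y \<in> \<Omega>" "x \<in> \<Omega>" "?k x y < e"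
        using U(3) that by auto
      then show ?thesis
        using triangle[of z x y] triangle[of z y x] z commute[of x y] by (simp add: dist_real_def abs_if)
    qed
    then show "\<forall>\<^sub>F y in at x within frontier V. dist (?k z y) (?k z x) < e"
      unfolding eventually_at_topological using U by blast
  qed
  \<comment> \<open>if \<open>V\<close> has no frontier, then nothing joins \<open>z\<close> to the outside and any radius will do\<close>
  obtain \<epsilon> where \<epsilon>: "\<epsilon> > 0" "\<And>x. x \<in> frontier V \<Longrightarrow> \<epsilon> \<le> ?k z x"
  proof (cases "frontier V = {}")
    case True
    then show ?thesis
      using that[of 1] by simp
  next
    case False
    then obtain x where x: "x \<in> frontier V" "\<forall>y\<in>frontier V. ?k z x \<le> ?k z y"
      using continuous_attains_inf[OF F(1) False cont] by blast
    then have "?k z x > 0"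
      using F(2,3) z by (metis mdist_pos_less subsetD)
    then show ?thesis
      using that x by blast
  qed
  have "mball z \<epsilon> \<subseteq> V"
  proof (rule subsetI, rule ccontr)
    fix w assume w: "w \<in> mball z \<epsilon>" "w \<notin> V"
    then obtain S where S: "connected S" "S \<subseteq> \<Omega>" "z \<in> S" "w \<in> S"
      "\<And>u. u \<in> S \<Longrightarrow> ?k z u + ?k u w < ?k z w + (\<epsilon> - ?k z w)"
      using kobayashi_near_geodesic[OF assms(1-4) z, of w "\<epsilon> - ?k z w"] by auto
    then have "S \<inter> frontier V \<noteq> {}"
      using connected_Int_frontier[OF S(1)] V(2) w(2) by blast
    then obtain u where u: "u \<in> S" "u \<in> frontier V"
      by blast
    then show False
      using S(5)[OF u(1)] \<epsilon>(2)[OF u(2)] nonneg[of u w] by linarith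
  qed
  then have "mball z \<epsilon> \<subseteq> C"
    using V(3) by blast
  then show ?thesis
    using that[OF \<open>compact C\<close> _ \<epsilon>(1)] r(4) unfolding C_def by blast
qed

text \<open>The manifold topology is finer because nearby points are joined by small discs, and coarser because
  small Kobayashi balls lie in small compact sets.\<close>

theorem kobayashi_inner_metric:
  fixes A :: "('x::{t2_space, second_countable_topology}, 'n::finite) atlas"
  assumes "complex_manifold A" "open \<Omega>" "connected \<Omega>" "kobayashi_hyperbolic A \<Omega>"
  shows "inner_metric \<Omega> (kobayashi A \<Omega>)"
proof -
  let ?k = "kobayashi A \<Omega>"
  have M: "Metric_space \<Omega> ?k"
    using assms(4) unfolding kobayashi_hyperbolic_def .
  interpret Metric_space \<Omega> ?k
    by (rule M)
  have top: "mtopology = top_of_set \<Omega>"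
  proof (rule topology_eq[THEN iffD2], intro allI iffI)
    fix W
    assume W: "openin mtopology W"
    have "\<exists>V. open V \<and> x \<in> V \<and> V \<subseteq> W" if x: "x \<in> W" for x
    proof -
      obtain \<epsilon> where "\<epsilon> > 0" "mball x \<epsilon> \<subseteq> W" "x \<in> \<Omega>"
        using W x unfolding openin_mtopology by blast
      then show ?thesis
        using kobayashi_ball_open_nbhd[OF assms(1,2) M, of x \<epsilon>] by (metis order_trans)
    qed
    then have "open W"
      by (subst open_subopen) blast
    then show "openin (top_of_set \<Omega>) W"
      using W openin_subset topspace_mtopology assms(2) by (metis openin_open_eq)
  next
    fix W
    assume "openin (top_of_set \<Omega>) W"
    then have W: "open W" "W \<subseteq> \<Omega>"
      using assms(2) by (simp_all add: openin_open_eq)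
    have "\<exists>r>0. mball x r \<subseteq> W" if x: "x \<in> W" for x
      using kobayashi_ball_small[OF assms(1-3) M W(1) x W(2)] by (metis order_trans)
    then show "openin mtopology W"
      unfolding openin_mtopology using W(2) by blast
  qed
  show ?thesis
  proof
    show "mtopology = top_of_set \<Omega>"
      by (rule top)
    show "\<exists>r>0. compactin mtopology (mcball z r)" if z: "z \<in> \<Omega>" for z
    proof -
      obtain C \<epsilon> where C: "compact C" "C \<subseteq> \<Omega>" "\<epsilon> > 0" "mball z \<epsilon> \<subseteq> C"
        using kobayashi_ball_small[OF assms(1-3) M assms(2) z order_refl] .
      have "compactin mtopology C"
        unfolding top using C(1,2) by (simp add: compactin_subtopology)
      moreover have "mcball z (\<epsilon> / 2) \<subseteq> C"
        using C(3) by (intro order_trans[OF _ C(4)]) auto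
      ultimately have "compactin mtopology (mcball z (\<epsilon> / 2))"
        by (rule closed_compactin) (rule closedin_mcball)
      then show ?thesis
        using C(3) half_gt_zero by blast
    qed
    show "\<exists>S. connected S \<and> S \<subseteq> \<Omega> \<and> z \<in> S \<and> w \<in> S \<and> (\<forall>u\<in>S. ?k z u + ?k u w < ?k z w + e)"
      if "z \<in> \<Omega>" "w \<in> \<Omega>" "0 < e" for z w e
      using kobayashi_near_geodesic[OF assms(1-3) M that] .
  qed
qed

section \<open>Ends of a sequentially compact end compactification\<close>

text \<open>Where \<open>closure \<Omega>\<close> is not locally connected, the components \<open>F j\<close> of an end may fail to be open.
  Sequential compactness compensates: the lemmas below show that \<open>F j\<close> is open away from a compact
  set, which makes convergence to an end mean what one expects.\<close>

locale sequential_end_space =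
  fixes \<Omega> :: "'x::{t2_space, second_countable_topology} set" and K :: "nat \<Rightarrow> 'x set"
  assumes exhaustion: "compact_exhaustion (closure \<Omega>) K"
    and sequentially_compact: "sequentially_compact_space (end_topology \<Omega> K)"
begin

lemma compact_K: "compact (K j)"
  and K_subset_interior: "K j \<subseteq> top_of_set (closure \<Omega>) interior_of K (Suc j)"
  and Union_K: "(\<Union>j. K j) = closure \<Omega>"
  using exhaustion unfolding compact_exhaustion_def by auto

lemma K_subset_closure: "K j \<subseteq> closure \<Omega>"
  using Union_K by blast

lemma K_mono: "i \<le> j \<Longrightarrow> K i \<subseteq> K j"
  by (rule lift_Suc_mono_le[of K]) (rule order_trans[OF K_subset_interior interior_of_subset])

lemma closed_K: "closed (K j)"
  by (rule compact_imp_closed[OF compact_K])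

lemma openin_diff_K: "openin (top_of_set (closure \<Omega>)) (closure \<Omega> - K j)"
  by (metis Diff_Compl closed_K double_complement inf_commute open_Compl openin_open_Int Diff_eq)

lemma K_nbhd:
  assumes "x \<in> closure \<Omega>"
  obtains U m where "open U" "x \<in> U" "U \<inter> closure \<Omega> \<subseteq> K m"
proof -
  obtain m where "x \<in> K m"
    using assms Union_K by blast
  then have "x \<in> top_of_set (closure \<Omega>) interior_of K (Suc m)"
    using K_subset_interior by blast
  then obtain T where "openin (top_of_set (closure \<Omega>)) T" "x \<in> T" "T \<subseteq> K (Suc m)"
    unfolding interior_of_def by blast
  then show ?thesis
    using that by (metis Int_commute IntD2 openin_open)
qed

lemma ends_antimono: "F \<in> ends \<Omega> K \<Longrightarrow> i \<le> j \<Longrightarrow> F j \<subseteq> F i"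
  by (rule lift_Suc_antimono_le[of F]) (simp_all add: ends_def)

lemma end_subset: "F \<in> ends \<Omega> K \<Longrightarrow> F j \<subseteq> closure \<Omega> - K j"
  using in_components_subset unfolding ends_def by fastforce

lemma limit_Inl_tendsto:
  assumes "limitin (end_topology \<Omega> K) (Inl \<circ> s) (Inl q) sequentially"
  shows "s \<longlonglongrightarrow> q"
proof (rule topological_tendstoI)
  fix U assume U: "open U" "q \<in> U"
  have "q \<in> closure \<Omega>"
    using limitin_topspace[OF assms] by (auto simp: topspace_end_topology end_space_def)
  let ?W = "Inl ` (U \<inter> closure \<Omega>) :: ('x + (nat \<Rightarrow> 'x set)) set"
  have "end_open \<Omega> K ?W"
    using U(1) by (intro end_openI) (auto simp: end_space_def)
  then have "\<forall>\<^sub>F n in sequentially. (Inl \<circ> s) n \<in> ?W"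
    using U(2) \<open>q \<in> closure \<Omega>\<close> by (intro limitinD[OF assms]) (auto simp: openin_end_topology)
  then show "\<forall>\<^sub>F n in sequentially. s n \<in> U"
    by eventually_elim auto
qed

lemma limit_Inl_eventually_K:
  assumes "limitin (end_topology \<Omega> K) (Inl \<circ> s) (Inl q) sequentially" "range s \<subseteq> closure \<Omega>"
  obtains m where "\<forall>\<^sub>F n in sequentially. s n \<in> K m"
proof -
  have "q \<in> closure \<Omega>"
    using limitin_topspace[OF assms(1)] by (auto simp: topspace_end_topology end_space_def)
  then obtain U m where U: "open U" "q \<in> U" "U \<inter> closure \<Omega> \<subseteq> K m"
    by (rule K_nbhd)
  have "\<forall>\<^sub>F n in sequentially. s n \<in> U"
    using U(1,2) by (rule topological_tendstoD[OF limit_Inl_tendsto[OF assms(1)]])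
  then have "\<forall>\<^sub>F n in sequentially. s n \<in> K m"
    by eventually_elim (use U assms(2) in auto)
  then show ?thesis
    by (rule that)
qed

lemma limit_Inr_eventually_not_K:
  assumes "limitin (end_topology \<Omega> K) (Inl \<circ> s) (Inr F) sequentially"
  shows "\<forall>\<^sub>F n in sequentially. s n \<notin> K j"
proof -
  have "F \<in> ends \<Omega> K"
    using limitin_topspace[OF assms] by (auto simp: topspace_end_topology end_space_def)
  have "end_open \<Omega> K (end_space \<Omega> K - Inl ` K j)"
  proof (rule end_openI)
    fix x assume "Inl x \<in> end_space \<Omega> K - Inl ` K j"
    then show "\<exists>U. open U \<and> x \<in> U \<and> Inl ` (U \<inter> closure \<Omega>) \<subseteq> end_space \<Omega> K - Inl ` K j"
      using closed_K[of j] by (intro exI[of _ "- K j"]) (auto simp: end_space_def)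
  next
    fix G assume "Inr G \<in> end_space \<Omega> K - Inl ` K j"
    then have "G \<in> ends \<Omega> K"
      by (auto simp: end_space_def)
    then have "end_nbhd \<Omega> K G j \<subseteq> end_space \<Omega> K - Inl ` K j"
      using end_subset[of G j] by (auto simp: end_nbhd_def end_space_def)
    then show "\<exists>j'. end_nbhd \<Omega> K G j' \<subseteq> end_space \<Omega> K - Inl ` K j" ..
  qed auto
  then have "\<forall>\<^sub>F n in sequentially. (Inl \<circ> s) n \<in> end_space \<Omega> K - Inl ` K j"
    using \<open>F \<in> ends \<Omega> K\<close>
    by (intro limitinD[OF assms]) (auto simp: openin_end_topology end_space_def)
  then show ?thesis
    by eventually_elim auto
qed

lemma convergent_subsequence:
  fixes s :: "nat \<Rightarrow> 'x"
  assumes "range s \<subseteq> closure \<Omega>"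
  obtains l and r :: "nat \<Rightarrow> nat" where "strict_mono r" "limitin (end_topology \<Omega> K) (Inl \<circ> (s \<circ> r)) l sequentially"
proof -
  have "range (Inl \<circ> s) \<subseteq> topspace (end_topology \<Omega> K)"
    using assms by (auto simp: topspace_end_topology end_space_def)
  from sequentially_compact[unfolded sequentially_compact_space_def, rule_format, OF this]
  obtain l and r :: "nat \<Rightarrow> nat" where "strict_mono r" "limitin (end_topology \<Omega> K) ((Inl \<circ> s) \<circ> r) l sequentially"
    by (elim exE conjE)
  then show ?thesis
    using that by (simp add: comp_assoc)
qed

text \<open>If each end had a component containing only finitely many terms, it would also have one containing
  none.  Removing all terms from the space would then leave an open set that contains every end, and no
  subsequence could converge to an end; it cannot converge to a point either, as the terms leave
  every compact set.\<close>

lemma end_of_escaping_sequence: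
  assumes w: "range w \<subseteq> closure \<Omega>" and esc: "\<And>j. \<forall>\<^sub>F n in sequentially. w n \<notin> K j"
  obtains H where "H \<in> ends \<Omega> K" "\<And>i. infinite {n. w n \<in> H i}"
proof (rule ccontr)
  assume "\<not> thesis"
  then have fin: "\<exists>i. finite {n. w n \<in> H i}" if "H \<in> ends \<Omega> K" for H
    using that \<open>\<And>H. \<lbrakk>H \<in> ends \<Omega> K; \<And>i. infinite {n. w n \<in> H i}\<rbrakk> \<Longrightarrow> thesis\<close> by blast
  have finK: "finite {n. w n \<in> K j}" for j
    using esc[of j] by (simp add: eventually_cofinite flip: cofinite_eq_sequentially)
  let ?W = "end_space \<Omega> K - Inl ` range w"
  have "end_open \<Omega> K ?W"
  proof (rule end_openI)
    fix x assume x: "Inl x \<in> ?W"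
    then have "x \<in> closure \<Omega>"
      by (auto simp: end_space_def)
    then obtain U m where U: "open U" "x \<in> U" "U \<inter> closure \<Omega> \<subseteq> K m"
      by (rule K_nbhd)
    have "finite (w ` {n. w n \<in> K m})"
      using finK by blast
    then have "open (U - w ` {n. w n \<in> K m})"
      using U(1) by (intro open_Diff finite_imp_closed)
    moreover have "Inl ` ((U - w ` {n. w n \<in> K m}) \<inter> closure \<Omega>) \<subseteq> ?W"
      using U(3) w by (auto simp: end_space_def)
    ultimately show "\<exists>U. open U \<and> x \<in> U \<and> Inl ` (U \<inter> closure \<Omega>) \<subseteq> ?W"
      using x U(2) by (intro exI[of _ "U - w ` {n. w n \<in> K m}"]) auto
  next
    fix H assume "Inr H \<in> ?W"
    then have H: "H \<in> ends \<Omega> K"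
      by (auto simp: end_space_def)
    then obtain i where "finite {n. w n \<in> H i}"
      using fin by blast
    moreover have "\<exists>j. w n \<in> K j" for n
      using w Union_K by blast
    then obtain J where J: "\<And>n. w n \<in> K (J n)"
      by metis
    ultimately obtain j where j: "\<And>n. w n \<in> H i \<Longrightarrow> J n \<le> j"
      by (metis finite_nat_set_iff_bounded_le finite_imageI imageI mem_Collect_eq)
    have "w n \<notin> H (max i j)" for n
    proof
      assume a: "w n \<in> H (max i j)"
      then have "J n \<le> max i j"
        using j ends_antimono[OF H, of i "max i j"] by (meson max.coboundedI2 max.cobounded1 subsetD)
      then show False
        using J[of n] K_mono end_subset[OF H] a by blast
    qed
    then have "end_nbhd \<Omega> K H (max i j) \<subseteq> ?W"
      using end_subset[OF H, of "max i j"] by (auto simp: end_nbhd_def end_space_def)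
    then show "\<exists>j. end_nbhd \<Omega> K H j \<subseteq> ?W" ..
  qed auto
  obtain l r where r: "strict_mono r" "limitin (end_topology \<Omega> K) (Inl \<circ> (w \<circ> r)) l sequentially"
    using convergent_subsequence[OF w] .
  show False
  proof (cases l)
    case (Inl q)
    have "range (w \<circ> r) \<subseteq> closure \<Omega>"
      using w by auto
    with r(2) obtain m where "\<forall>\<^sub>F n in sequentially. (w \<circ> r) n \<in> K m"
      unfolding Inl by (rule limit_Inl_eventually_K)
    moreover have "\<forall>\<^sub>F n in sequentially. w (r n) \<notin> K m"
      using eventually_subseq[OF r(1) esc] .
    ultimately have "\<forall>\<^sub>F n in sequentially. False"
      by eventually_elim simp
    then show False
      by simp
  next
    case (Inr G)
    then have "l \<in> ?W"
      using limitin_topspace[OF r(2)] by (auto simp: topspace_end_topology)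
    then have "\<forall>\<^sub>F n in sequentially. (Inl \<circ> (w \<circ> r)) n \<in> ?W"
      using \<open>end_open \<Omega> K ?W\<close> by (intro limitinD[OF r(2)]) (auto simp: openin_end_topology)
    then have "\<forall>\<^sub>F n :: nat in sequentially. False"
      by eventually_elim auto
    then show False
      by simp
  qed
qed

text \<open>Otherwise one could choose points escaping to infinity in pairwise different components, while an
  end as in \<open>end_of_escaping_sequence\<close> captures infinitely many of them in a single component.\<close>

lemma finite_components_outside_K:
  "\<exists>m. finite {C \<in> components (closure \<Omega> - K j). \<not> C \<subseteq> K m}"
proof (rule ccontr)
  define \<C> where "\<C> m = {C \<in> components (closure \<Omega> - K j). \<not> C \<subseteq> K m}" for m
  assume not: "\<not> ?thesis"
  have inf: "infinite (\<C> m)" for m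
    unfolding \<C>_def using not by (rule contrapos_nn) (rule exI)
  have ex: "\<exists>C. C \<in> \<C> m \<and> C \<notin> F" if "finite F" for m F
  proof -
    have "\<not> \<C> m \<subseteq> F"
      using inf[of m] finite_subset[OF _ that] by blast
    then show ?thesis
      by blast
  qed
  \<comment> \<open>the first entry collects the components used so far, the second is the current one\<close>
  have "\<exists>g. \<forall>n. (finite (fst (g n)) \<and> snd (g n) \<in> fst (g n) \<and> snd (g n) \<in> \<C> n) \<and>
      (fst (g n) \<subseteq> fst (g (Suc n)) \<and> snd (g (Suc n)) \<notin> fst (g n))"
  proof (rule dependent_nat_choice)
    obtain C where "C \<in> \<C> 0"
      using ex[of "{}"] by blast
    then show "\<exists>x. finite (fst x) \<and> snd x \<in> fst x \<and> snd x \<in> \<C> 0"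
      by (intro exI[of _ "({C}, C)"]) simp
    fix x :: "'x set set \<times> 'x set" and n
    assume x: "finite (fst x) \<and> snd x \<in> fst x \<and> snd x \<in> \<C> n"
    obtain C where "C \<in> \<C> (Suc n)" "C \<notin> fst x"
      using ex[of "fst x"] x by blast
    then show "\<exists>y. (finite (fst y) \<and> snd y \<in> fst y \<and> snd y \<in> \<C> (Suc n)) \<and>
        (fst x \<subseteq> fst y \<and> snd y \<notin> fst x)"
      using x by (intro exI[of _ "(insert C (fst x), C)"]) auto
  qed
  then obtain g where g: "\<forall>n. (finite (fst (g n)) \<and> snd (g n) \<in> fst (g n) \<and> snd (g n) \<in> \<C> n) \<and>
      (fst (g n) \<subseteq> fst (g (Suc n)) \<and> snd (g (Suc n)) \<notin> fst (g n))" ..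
  have g_mem: "snd (g n) \<in> fst (g n)" "snd (g n) \<in> \<C> n"
    and g_mono: "fst (g n) \<subseteq> fst (g (Suc n))" and g_new: "snd (g (Suc n)) \<notin> fst (g n)" for n
    using spec[OF g, of n] by simp_all
  define C where "C n = snd (g n)" for n
  have C_neq: "C n \<noteq> C m" if "m < n" for m n
  proof -
    have "fst (g m) \<subseteq> fst (g (n - 1))"
      by (rule lift_Suc_mono_le[of "\<lambda>n. fst (g n)", OF g_mono]) (use that in simp)
    then show ?thesis
      using g_mem(1)[of m] g_new[of "n - 1"] that unfolding C_def by auto
  qed
  have "\<exists>x. x \<in> C n \<and> x \<notin> K n" for n
    using g_mem(2)[of n] unfolding C_def \<C>_def by blast
  then obtain w where w: "\<And>n. w n \<in> C n" "\<And>n. w n \<notin> K n"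
    by metis
  have C_comp: "C n \<in> components (closure \<Omega> - K j)" for n
    using g_mem(2)[of n] unfolding C_def \<C>_def by blast
  have "range w \<subseteq> closure \<Omega>"
    using w(1) in_components_subset[OF C_comp] by blast
  moreover have "\<forall>\<^sub>F n in sequentially. w n \<notin> K i" for i
    using eventually_ge_at_top[of i] by eventually_elim (use w(2) K_mono in blast)
  ultimately obtain H where H: "H \<in> ends \<Omega> K" "\<And>i. infinite {n. w n \<in> H i}"
    using end_of_escaping_sequence by blast
  have "H j \<in> components (closure \<Omega> - K j)"
    using H(1) unfolding ends_def by blast
  then have eq: "C n = H j" if "w n \<in> H j" for n
    using components_nonoverlap[OF C_comp] w(1)[of n] that by blast
  obtain m n where "m < n" "w m \<in> H j" "w n \<in> H j"
    using H(2)[of j] unfolding infinite_nat_iff_unbounded by (metis mem_Collect_eq)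
  then show False
    using eq C_neq by metis
qed

text \<open>Outside a large compact set only finitely many other components remain, and each of them is closed.\<close>

lemma end_component_open:
  assumes F: "F \<in> ends \<Omega> K"
  obtains m where "j \<le> m" "openin (top_of_set (closure \<Omega>)) (F j - K m)"
proof -
  let ?X = "closure \<Omega> - K j"
  obtain m0 where m0: "finite {C \<in> components ?X. \<not> C \<subseteq> K m0}"
    using finite_components_outside_K by blast
  define m where "m = max j m0"
  let ?\<C> = "{C \<in> components ?X. C \<noteq> F j \<and> \<not> C \<subseteq> K m}"
  have "finite ?\<C>"
  proof (rule finite_subset[OF _ m0])
    have "K m0 \<subseteq> K m"
      by (rule K_mono) (simp add: m_def)
    then show "?\<C> \<subseteq> {C \<in> components ?X. \<not> C \<subseteq> K m0}"
      by blast
  qed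
  then have "closedin (top_of_set ?X) (\<Union>?\<C>)"
    by (intro closedin_Union) (auto intro: closedin_component)
  then have "openin (top_of_set ?X) (?X - \<Union>?\<C>)"
    by (rule openin_diff[OF openin_subtopology_self])
  then have "openin (top_of_set (closure \<Omega>)) (?X - \<Union>?\<C>)"
    using openin_diff_K by (rule openin_trans)
  then have "openin (top_of_set (closure \<Omega>)) ((?X - \<Union>?\<C>) \<inter> (closure \<Omega> - K m))"
    using openin_diff_K by (rule openin_Int)
  moreover have "(?X - \<Union>?\<C>) \<inter> (closure \<Omega> - K m) = F j - K m"
  proof
    have Fj: "F j \<in> components ?X"
      using F unfolding ends_def by blast
    show "(?X - \<Union>?\<C>) \<inter> (closure \<Omega> - K m) \<subseteq> F j - K m"
    proof
      fix x assume x: "x \<in> (?X - \<Union>?\<C>) \<inter> (closure \<Omega> - K m)"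
      then obtain C where "C \<in> components ?X" "x \<in> C"
        using Union_components[of ?X] by blast
      then show "x \<in> F j - K m"
        using x by blast
    qed
    have "F j \<inter> C = {}" if "C \<in> ?\<C>" for C
      using components_nonoverlap[OF Fj, of C] that by blast
    then show "F j - K m \<subseteq> (?X - \<Union>?\<C>) \<inter> (closure \<Omega> - K m)"
      using in_components_subset[OF Fj] by blast
  qed
  ultimately show ?thesis
    using that[of m] by (simp add: m_def)
qed

lemma limit_Inr_eventually_component:
  assumes lim: "limitin (end_topology \<Omega> K) (Inl \<circ> s) (Inr F) sequentially"
  shows "\<forall>\<^sub>F n in sequentially. s n \<in> F j"
proof -
  have F: "F \<in> ends \<Omega> K"
    using limitin_topspace[OF lim] by (auto simp: topspace_end_topology end_space_def)
  obtain m where m: "j \<le> m" "openin (top_of_set (closure \<Omega>)) (F j - K m)"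
    using end_component_open[OF F] .
  let ?V = "Inl ` (F j - K m) \<union> Inr ` {G \<in> ends \<Omega> K. G j = F j}"
  have "end_open \<Omega> K ?V"
  proof (rule end_openI)
    show "?V \<subseteq> end_space \<Omega> K"
      using end_subset[OF F] by (auto simp: end_space_def)
    fix x assume "Inl x \<in> ?V"
    then have x: "x \<in> F j - K m"
      by auto
    obtain U where U: "open U" "F j - K m = closure \<Omega> \<inter> U"
      using m(2) unfolding openin_open by blast
    then show "\<exists>U. open U \<and> x \<in> U \<and> Inl ` (U \<inter> closure \<Omega>) \<subseteq> ?V"
      using x by (intro exI[of _ U]) auto
  next
    fix G assume "Inr G \<in> ?V"
    then have G: "G \<in> ends \<Omega> K" "G j = F j"
      by auto
    have "end_nbhd \<Omega> K G m \<subseteq> ?V"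
      using ends_antimono[OF G(1) m(1)] end_subset[OF G(1), of m] G(2) m(1)
      by (auto simp: end_nbhd_def)
    then show "\<exists>j. end_nbhd \<Omega> K G j \<subseteq> ?V" ..
  qed
  then have "\<forall>\<^sub>F n in sequentially. (Inl \<circ> s) n \<in> ?V"
    using F by (intro limitinD[OF lim]) (auto simp: openin_end_topology)
  then show ?thesis
    by eventually_elim auto
qed

end

section \<open>Escaping sequences at bounded distance from each other\<close>

locale boundary_separating_metric = inner_metric \<Omega> d + sequential_end_space \<Omega> K
  for \<Omega> :: "'x::{t2_space, second_countable_topology} set" and d K +
  assumes complete: mcomplete
    and open_domain: "open \<Omega>"
    and boundary_separated: "\<lbrakk>x \<in> frontier \<Omega>; y \<in> frontier \<Omega>; x \<noteq> y\<rbrakk> \<Longrightarrow>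
      filterlim (\<lambda>(z, w). d z w) at_top (at (x, y) within \<Omega> \<times> \<Omega>)"
begin

lemma escape_near:
  assumes "filterlim (\<lambda>n. d p (u n)) at_top F" "p \<in> \<Omega>" "\<And>n. u n \<in> \<Omega>" "\<And>n. v n \<in> \<Omega>"
    and "\<And>n. d (u n) (v n) \<le> C"
  shows "filterlim (\<lambda>n. d p (v n)) at_top F"
proof (rule filterlim_at_top_mono)
  show "filterlim (\<lambda>n. - C + d p (u n)) at_top F"
    using assms(1) by (rule filterlim_tendsto_add_at_top[OF tendsto_const])
  have "- C + d p (u n) \<le> d p (v n)" for n
    using triangle[OF assms(2,4,3), of n n] commute[of "v n" "u n"] assms(5)[of n] by simp
  then show "\<forall>\<^sub>F n in F. - C + d p (u n) \<le> d p (v n)"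
    by simp
qed

lemma escaping_limit_not_in_domain:
  assumes "filterlim (\<lambda>n. d p (u n)) at_top sequentially" "p \<in> \<Omega>" "\<And>n. u n \<in> \<Omega>" "u \<longlonglongrightarrow> q"
  shows "q \<notin> \<Omega>"
proof
  assume "q \<in> \<Omega>"
  have "(\<lambda>n. d p (u n)) \<longlonglongrightarrow> d p q"
    using assms(3,4) \<open>q \<in> \<Omega>\<close>
    by (intro continuous_on_tendsto_compose[OF continuous_on_dist[OF assms(2)]]) auto
  then show False
    using assms(1) not_tendsto_and_filterlim_at_infinity[OF trivial_limit_sequentially]
      filterlim_at_top_imp_at_infinity by blast
qed

lemma escaping_limit_frontier:
  assumes "filterlim (\<lambda>n. d p (u n)) at_top sequentially" "p \<in> \<Omega>" "\<And>n. u n \<in> \<Omega>" "u \<longlonglongrightarrow> q"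
    and "q \<in> closure \<Omega>"
  shows "q \<in> frontier \<Omega>"
  using escaping_limit_not_in_domain[OF assms(1-4)] assms(5) open_domain
  by (simp add: frontier_def interior_open)

lemma frontier_limits_far_apart:
  assumes "x \<in> frontier \<Omega>" "y \<in> frontier \<Omega>" "x \<noteq> y" "u \<longlonglongrightarrow> x" "v \<longlonglongrightarrow> y"
    and "\<And>n. u n \<in> \<Omega>" "\<And>n. v n \<in> \<Omega>"
  shows "filterlim (\<lambda>n. d (u n) (v n)) at_top sequentially"
proof -
  have "x \<notin> \<Omega>"
    using assms(1) open_domain by (simp add: frontier_def interior_open)
  then have "filterlim (\<lambda>n. (u n, v n)) (at (x, y) within \<Omega> \<times> \<Omega>) sequentially"
    using assms(4-7) unfolding filterlim_at by (auto intro!: tendsto_Pair always_eventually)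
  then show ?thesis
    using filterlim_compose[OF boundary_separated[OF assms(1-3)]] by fastforce
qed

lemma bounded_not_at_top:
  assumes "\<And>n. (g n :: real) \<le> C"
  shows "\<not> filterlim g at_top sequentially"
proof
  assume "filterlim g at_top sequentially"
  then have "\<forall>\<^sub>F n in sequentially. C + 1 \<le> g n"
    by (simp add: filterlim_at_top)
  then obtain n where "C + 1 \<le> g n"
    using eventually_happens' sequentially_bot by blast
  then show False
    using assms[of n] by simp
qed

text \<open>A set meeting \<open>K m\<close> but not contained in \<open>K (Suc m)\<close> also meets the frontier of \<open>K (Suc m)\<close>.  If this
  happened infinitely often, points in \<open>K m\<close> and on that frontier would have limits by compactness.
  These limits are different because \<open>K m\<close> is interior to \<open>K (Suc m)\<close>, and they lie on \<open>frontier \<Omega>\<close>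
  because the points escape; yet the points stay at bounded distance.\<close>

lemma connected_sets_do_not_cross:
  assumes esc: "filterlim (\<lambda>n. d p (u n)) at_top sequentially" and p: "p \<in> \<Omega>"
    and S: "\<And>n. connected (S n)" "\<And>n. S n \<subseteq> \<Omega>" "\<And>n. u n \<in> S n" "\<And>n x. x \<in> S n \<Longrightarrow> d (u n) x \<le> C"
  shows "\<forall>\<^sub>F n in sequentially. S n \<inter> K m = {} \<or> S n \<subseteq> K (Suc m)"
proof (rule ccontr)
  let ?X = "top_of_set (closure \<Omega>)"
  define Fr where "Fr = ?X frontier_of K (Suc m)"
  assume "\<not> ?thesis"
  from not_eventually_sequentiallyD[OF this]
  obtain r :: "nat \<Rightarrow> nat" where r: "strict_mono r" "\<forall>n. \<not> (S (r n) \<inter> K m = {} \<or> S (r n) \<subseteq> K (Suc m))"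
    by (elim exE conjE) (rule that)
  have u\<Omega>: "u n \<in> \<Omega>" for n
    using S(2,3) by blast
  have "S (r n) \<inter> Fr \<noteq> {}" for n
    unfolding Fr_def
  proof (rule connectedin_Int_frontier_of)
    show "connectedin ?X (S (r n))"
      using S(1,2) closure_subset unfolding connectedin_subtopology by (metis connectedin_iff_connected order_trans)
    show "S (r n) \<inter> K (Suc m) \<noteq> {}"
      using spec[OF r(2), of n] K_mono[of m "Suc m"] by auto
    show "S (r n) - K (Suc m) \<noteq> {}"
      using spec[OF r(2), of n] by auto
  qed
  then have "\<exists>x. x \<in> S (r n) \<and> x \<in> K m" "\<exists>x. x \<in> S (r n) \<and> x \<in> Fr" for n
    using spec[OF r(2), of n] by blast+
  then obtain a b where a: "\<And>n. a n \<in> S (r n)" "\<And>n. a n \<in> K m" and b: "\<And>n. b n \<in> S (r n)" "\<And>n. b n \<in> Fr"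
    by metis
  have "closedin ?X (K (Suc m))"
    using closed_K K_subset_closure by (simp add: closed_subset)
  then have "Fr \<subseteq> K (Suc m)"
    unfolding Fr_def by (rule frontier_of_subset_closedin)
  moreover have "closed Fr"
    unfolding Fr_def by (meson closedin_closed_trans closedin_frontier_of closed_closure)
  ultimately have "compact Fr"
    using compact_Int_closed[OF compact_K] by (metis inf.absorb_iff2)
  then have "seq_compact (K m \<times> Fr)"
    by (intro compact_imp_seq_compact compact_Times compact_K)
  moreover have "\<forall>n. (a n, b n) \<in> K m \<times> Fr"
    using a(2) b(2) by simp
  ultimately obtain l s where l: "l \<in> K m \<times> Fr" "strict_mono s" "((\<lambda>n. (a n, b n)) \<circ> s) \<longlonglongrightarrow> l"
    by (rule seq_compactE)
  obtain \<alpha> \<beta> where l_eq: "l = (\<alpha>, \<beta>)"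
    by (cases l)
  have lim: "(\<lambda>n. a (s n)) \<longlonglongrightarrow> \<alpha>" "(\<lambda>n. b (s n)) \<longlonglongrightarrow> \<beta>"
    using tendsto_fst[OF l(3)] tendsto_snd[OF l(3)] unfolding l_eq by (simp_all add: o_def)
  have sub: "a n \<in> \<Omega>" "b n \<in> \<Omega>" for n
    using a(1) b(1) S(2) by blast+
  have "strict_mono (r \<circ> s)"
    using r(1) l(2) by (rule strict_mono_o)
  then have esc': "filterlim (\<lambda>n. d p (u (r (s n)))) at_top sequentially"
    using filterlim_compose[OF esc filterlim_subseq] by fastforce
  have esc_a: "filterlim (\<lambda>n. d p (a (s n))) at_top sequentially"
    by (rule escape_near[OF esc' p u\<Omega> sub(1) S(4)[OF a(1)]])
  have esc_b: "filterlim (\<lambda>n. d p (b (s n))) at_top sequentially"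
    by (rule escape_near[OF esc' p u\<Omega> sub(2) S(4)[OF b(1)]])
  have "\<alpha> \<in> K m" "\<beta> \<in> Fr"
    using l(1) unfolding l_eq by auto
  then have "\<alpha> \<in> frontier \<Omega>" "\<beta> \<in> frontier \<Omega>"
    using escaping_limit_frontier[OF esc_a p sub(1) lim(1)] escaping_limit_frontier[OF esc_b p sub(2) lim(2)]
      K_subset_closure \<open>Fr \<subseteq> K (Suc m)\<close> by auto
  moreover have "\<alpha> \<noteq> \<beta>"
    using \<open>\<alpha> \<in> K m\<close> \<open>\<beta> \<in> Fr\<close> K_subset_interior[of m] unfolding Fr_def frontier_of_def by auto
  ultimately have "filterlim (\<lambda>n. d (a (s n)) (b (s n))) at_top sequentially"
    using lim sub by (intro frontier_limits_far_apart)
  moreover have "d (a (s n)) (b (s n)) \<le> C + C" for n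
    using triangle[of "a (s n)" "u (r (s n))" "b (s n)", OF sub(1) u\<Omega> sub(2)] commute[of "a (s n)" "u (r (s n))"]
      S(4)[OF a(1), of "s n"] S(4)[OF b(1), of "s n"] by linarith
  ultimately show False
    using bounded_not_at_top[of "\<lambda>n. d (a (s n)) (b (s n))"] by blast
qed

lemma bounded_distance_arcs:
  assumes "\<And>n. u n \<in> \<Omega>" "\<And>n. v n \<in> \<Omega>" "\<And>n. d (u n) (v n) \<le> C"
  shows "\<exists>S. \<forall>n. connected (S n) \<and> S n \<subseteq> \<Omega> \<and> u n \<in> S n \<and> v n \<in> S n \<and> (\<forall>x\<in>S n. d (u n) x \<le> C + 1)"
proof (rule choice, rule allI)
  fix n
  obtain S where S: "connected S" "S \<subseteq> \<Omega>" "u n \<in> S" "v n \<in> S"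
    "\<forall>x\<in>S. d (u n) x + d x (v n) < d (u n) (v n) + 1"
    using near_geodesic[OF assms(1,2) zero_less_one] by blast
  have "d (u n) x \<le> C + 1" if "x \<in> S" for x
    using S(5)[rule_format, OF that] nonneg[of x "v n"] assms(3)[of n] by linarith
  then show "\<exists>S. connected S \<and> S \<subseteq> \<Omega> \<and> u n \<in> S \<and> v n \<in> S \<and> (\<forall>x\<in>S. d (u n) x \<le> C + 1)"
    using S(1-4) by blast
qed

lemma point_and_end_limits_not_close:
  assumes esc: "filterlim (\<lambda>n. d p (u n)) at_top sequentially" and p: "p \<in> \<Omega>"
    and uv: "\<And>n. u n \<in> \<Omega>" "\<And>n. v n \<in> \<Omega>" "\<And>n. d (u n) (v n) \<le> C"
    and u: "limitin (end_topology \<Omega> K) (Inl \<circ> u) (Inl x) sequentially"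
    and v: "limitin (end_topology \<Omega> K) (Inl \<circ> v) (Inr G) sequentially"
  shows False
proof -
  obtain S where "\<forall>n. connected (S n) \<and> S n \<subseteq> \<Omega> \<and> u n \<in> S n \<and> v n \<in> S n \<and> (\<forall>x\<in>S n. d (u n) x \<le> C + 1)"
    using bounded_distance_arcs[of u v C, OF uv] by (rule exE)
  then have S: "\<And>n. connected (S n)" "\<And>n. S n \<subseteq> \<Omega>" "\<And>n. u n \<in> S n" "\<And>n. v n \<in> S n"
    "\<And>n x. x \<in> S n \<Longrightarrow> d (u n) x \<le> C + 1"
    by simp_all
  have "range u \<subseteq> closure \<Omega>"
    using uv(1) closure_subset by blast
  with u obtain m where m: "\<forall>\<^sub>F n in sequentially. u n \<in> K m"
    by (rule limit_Inl_eventually_K)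
  have "\<forall>\<^sub>F n in sequentially. S n \<inter> K m = {} \<or> S n \<subseteq> K (Suc m)"
    using connected_sets_do_not_cross[OF esc p S(1-3,5)] .
  moreover have "\<forall>\<^sub>F n in sequentially. v n \<notin> K (Suc m)"
    using limit_Inr_eventually_not_K[OF v] .
  ultimately have "\<forall>\<^sub>F n :: nat in sequentially. False"
    using m
  proof eventually_elim
    case (elim n)
    then show ?case
      using S(3,4)[of n] by blast
  qed
  then show False
    by simp
qed

text \<open>Two points of \<open>closure \<Omega>\<close> are separated by the hypothesis on \<open>frontier \<Omega>\<close>; a point and an end, or two
  ends, by the connected sets joining the sequences, which cannot cross the shells of the
  exhaustion.\<close>

lemma bounded_distance_limits_equal:
  assumes esc: "filterlim (\<lambda>n. d p (u n)) at_top sequentially" and p: "p \<in> \<Omega>"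
    and uv: "\<And>n. u n \<in> \<Omega>" "\<And>n. v n \<in> \<Omega>" "\<And>n. d (u n) (v n) \<le> C"
    and u: "limitin (end_topology \<Omega> K) (Inl \<circ> u) x sequentially"
    and v: "limitin (end_topology \<Omega> K) (Inl \<circ> v) y sequentially"
  shows "x = y"
proof -
  have esc_v: "filterlim (\<lambda>n. d p (v n)) at_top sequentially"
    using escape_near[OF esc p uv] .
  have vu: "d (v n) (u n) \<le> C" for n
    using uv(3)[of n] commute by simp
  show ?thesis
  proof (cases x; cases y)
    fix a b
    assume xy: "x = Inl a" "y = Inl b"
    then have "u \<longlonglongrightarrow> a" "v \<longlonglongrightarrow> b" "a \<in> closure \<Omega>" "b \<in> closure \<Omega>"
      using u v limit_Inl_tendsto limitin_topspace[OF u] limitin_topspace[OF v]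
      by (auto simp: topspace_end_topology end_space_def)
    then have "a = b"
      using escaping_limit_frontier[OF esc p uv(1)] escaping_limit_frontier[OF esc_v p uv(2)]
        frontier_limits_far_apart[of a b u v] uv bounded_not_at_top[of "\<lambda>n. d (u n) (v n)" C] by blast
    then show ?thesis
      using xy by simp
  next
    fix a G
    assume "x = Inl a" "y = Inr G"
    then show ?thesis
      using point_and_end_limits_not_close[OF esc p uv] u v by blast
  next
    fix F b
    assume "x = Inr F" "y = Inl b"
    then show ?thesis
      using point_and_end_limits_not_close[OF esc_v p uv(2,1) vu] u v by blast
  next
    fix F G
    assume xy: "x = Inr F" "y = Inr G"
    then have FG: "F \<in> ends \<Omega> K" "G \<in> ends \<Omega> K"
      using limitin_topspace[OF u] limitin_topspace[OF v] by (auto simp: topspace_end_topology end_space_def)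
    obtain S where "\<forall>n. connected (S n) \<and> S n \<subseteq> \<Omega> \<and> u n \<in> S n \<and> v n \<in> S n \<and> (\<forall>x\<in>S n. d (u n) x \<le> C + 1)"
      using bounded_distance_arcs[of u v C, OF uv] by (rule exE)
    then have S: "\<And>n. connected (S n)" "\<And>n. S n \<subseteq> \<Omega>" "\<And>n. u n \<in> S n" "\<And>n. v n \<in> S n"
      "\<And>n x. x \<in> S n \<Longrightarrow> d (u n) x \<le> C + 1"
      by simp_all
    have "F j = G j" for j
    proof -
      have "\<forall>\<^sub>F n in sequentially. S n \<inter> K j = {} \<or> S n \<subseteq> K (Suc j)"
        using connected_sets_do_not_cross[OF esc p S(1-3,5)] .
      moreover have "\<forall>\<^sub>F n in sequentially. u n \<notin> K (Suc j)"
        using limit_Inr_eventually_not_K u unfolding xy(1) by blast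
      moreover have "\<forall>\<^sub>F n in sequentially. u n \<in> F j"
        using limit_Inr_eventually_component u unfolding xy(1) by blast
      moreover have "\<forall>\<^sub>F n in sequentially. v n \<in> G j"
        using limit_Inr_eventually_component v unfolding xy(2) by blast
      ultimately have "\<forall>\<^sub>F n in sequentially. S n \<inter> K j = {} \<and> u n \<in> F j \<and> v n \<in> G j"
      proof eventually_elim
        case (elim n)
        then show ?case
          using S(3)[of n] by blast
      qed
      then obtain n where n: "S n \<inter> K j = {}" "u n \<in> F j" "v n \<in> G j"
        using eventually_happens' sequentially_bot by blast
      have comp: "F j \<in> components (closure \<Omega> - K j)" "G j \<in> components (closure \<Omega> - K j)"
        using FG unfolding ends_def by blast+
      have sub: "S n \<subseteq> closure \<Omega> - K j"
        using n(1) S(2)[of n] closure_subset[of \<Omega>] by blast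
      have "S n \<subseteq> F j"
        using S(3)[of n] n(2) by (intro components_maximal[OF comp(1) S(1) sub]) blast
      then show "F j = G j"
        using components_nonoverlap[OF comp] S(4)[of n] n(3) by blast
    qed
    then show ?thesis
      using xy by auto
  qed
qed

text \<open>By sequential compactness it suffices to identify the limits of convergent subsequences.\<close>

lemma bounded_distance_same_limit:
  assumes esc: "filterlim (\<lambda>n. d p (u n)) at_top sequentially" and p: "p \<in> \<Omega>"
    and uv: "\<And>n. u n \<in> \<Omega>" "\<And>n. v n \<in> \<Omega>" "\<And>n. d (u n) (v n) \<le> C"
    and u: "limitin (end_topology \<Omega> K) (Inl \<circ> u) x sequentially"
  shows "limitin (end_topology \<Omega> K) (Inl \<circ> v) x sequentially"
proof (rule ccontr)
  assume "\<not> ?thesis"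
  then obtain W where W: "openin (end_topology \<Omega> K) W" "x \<in> W" "\<not> (\<forall>\<^sub>F n in sequentially. (Inl \<circ> v) n \<in> W)"
    using limitin_topspace[OF u] unfolding limitin_def by blast
  from not_eventually_sequentiallyD[OF W(3)]
  obtain r :: "nat \<Rightarrow> nat" where r: "strict_mono r" "\<forall>n. (Inl \<circ> v) (r n) \<notin> W"
    by (elim exE conjE) (rule that)
  have "range (v \<circ> r) \<subseteq> closure \<Omega>"
    using uv(2) closure_subset by fastforce
  then obtain y and s :: "nat \<Rightarrow> nat" where s: "strict_mono s"
    "limitin (end_topology \<Omega> K) (Inl \<circ> (v \<circ> r \<circ> s)) y sequentially"
    by (rule convergent_subsequence)
  have rs: "strict_mono (r \<circ> s)"
    using r(1) s(1) by (rule strict_mono_o)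
  have "limitin (end_topology \<Omega> K) (Inl \<circ> (u \<circ> (r \<circ> s))) x sequentially"
    using limitin_subsequence[OF rs u] by (simp add: comp_assoc)
  moreover have "filterlim (\<lambda>n. d p ((u \<circ> (r \<circ> s)) n)) at_top sequentially"
    using filterlim_compose[OF esc filterlim_subseq[OF rs]] by (simp add: o_def)
  ultimately have "x = y"
    using s(2) uv
    by (intro bounded_distance_limits_equal[where u = "u \<circ> (r \<circ> s)" and v = "v \<circ> r \<circ> s" and C = C, OF _ p])
      auto
  then have "\<forall>\<^sub>F n in sequentially. (Inl \<circ> (v \<circ> r \<circ> s)) n \<in> W"
    using limitinD[OF s(2) W(1)] W(2) by blast
  then have "\<forall>\<^sub>F n :: nat in sequentially. False"
    by eventually_elim (use r(2) in auto)
  then show False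
    by simp
qed

end

section \<open>Horofunctions\<close>

lemma restrict_in_cont_funs: "continuous_on \<Omega> h \<Longrightarrow> restrict h \<Omega> \<in> cont_funs \<Omega>"
  unfolding cont_funs_def by (simp add: continuous_on_eq[of \<Omega> h])

lemma const_class_shift:
  assumes "\<And>z. z \<in> \<Omega> \<Longrightarrow> g z = h z + c"
  shows "const_class \<Omega> g = const_class \<Omega> h"
proof -
  have "(\<exists>a. \<forall>z\<in>\<Omega>. k z = g z + a) \<longleftrightarrow> (\<exists>a. \<forall>z\<in>\<Omega>. k z = h z + a)" for k :: "'a \<Rightarrow> real"
  proof
    assume "\<exists>a. \<forall>z\<in>\<Omega>. k z = g z + a"
    then obtain a where "\<forall>z\<in>\<Omega>. k z = g z + a" ..
    then show "\<exists>a. \<forall>z\<in>\<Omega>. k z = h z + a"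
      using assms by (intro exI[of _ "c + a"]) simp
  next
    assume "\<exists>a. \<forall>z\<in>\<Omega>. k z = h z + a"
    then obtain a where "\<forall>z\<in>\<Omega>. k z = h z + a" ..
    then show "\<exists>a. \<forall>z\<in>\<Omega>. k z = g z + a"
      using assms by (intro exI[of _ "a - c"]) simp
  qed
  then show ?thesis
    unfolding const_class_def by simp
qed

lemma const_class_restrict: "const_class \<Omega> (restrict h \<Omega>) = const_class \<Omega> h"
  by (rule const_class_shift[where c = 0]) simp

lemma restrict_in_const_class: "continuous_on \<Omega> h \<Longrightarrow> restrict h \<Omega> \<in> const_class \<Omega> h"
  using restrict_in_cont_funs[of \<Omega> h] unfolding const_class_def by (auto intro: exI[of _ 0])

lemma const_class_eqD:
  assumes "continuous_on \<Omega> h" "const_class \<Omega> h = const_class \<Omega> g"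
  shows "\<exists>c. \<forall>z\<in>\<Omega>. h z = g z + c"
proof -
  have "restrict h \<Omega> \<in> const_class \<Omega> g"
    using restrict_in_const_class[OF assms(1)] assms(2) by simp
  then obtain c where "\<forall>z\<in>\<Omega>. restrict h \<Omega> z = g z + c"
    unfolding const_class_def by blast
  then have "\<forall>z\<in>\<Omega>. h z = g z + c"
    by simp
  then show ?thesis ..
qed

lemma horofunction_const_class:
  assumes "continuous_on \<Omega> h" "p \<in> \<Omega>" "h p = 0"
  shows "horofunction p (const_class \<Omega> h) = restrict h \<Omega>"
  unfolding horofunction_def
proof (rule the_equality)
  show "restrict h \<Omega> \<in> const_class \<Omega> h \<and> restrict h \<Omega> p = 0"
    using restrict_in_const_class[OF assms(1)] assms(2,3) by simp
  fix k assume k: "k \<in> const_class \<Omega> h \<and> k p = 0"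
  then obtain c where c: "\<forall>z\<in>\<Omega>. k z = h z + c" and "k \<in> extensional \<Omega>"
    unfolding const_class_def cont_funs_def by blast
  then have "c = 0"
    using k assms(2,3) by simp
  then show "k = restrict h \<Omega>"
    using c \<open>k \<in> extensional \<Omega>\<close> by (intro extensionalityI[of _ \<Omega>]) auto
qed

lemma limitin_const_class:
  assumes cont: "\<And>n. continuous_on \<Omega> (g n)" "continuous_on \<Omega> h"
    and unif: "\<And>L \<epsilon>. \<lbrakk>compact L; L \<subseteq> \<Omega>; \<epsilon> > 0\<rbrakk> \<Longrightarrow> \<forall>\<^sub>F n in F. \<forall>z\<in>L. \<bar>g n z - h z\<bar> < \<epsilon>"
  shows "limitin (quotient_topology \<Omega>) (\<lambda>n. const_class \<Omega> (g n)) (const_class \<Omega> h) F"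
proof -
  have "limitin (luc_topology \<Omega>) (\<lambda>n. restrict (g n) \<Omega>) (restrict h \<Omega>) F"
    unfolding limitin_def topspace_luc_topology openin_luc_topology
  proof (intro conjI allI impI)
    show "restrict h \<Omega> \<in> cont_funs \<Omega>"
      using cont(2) by (rule restrict_in_cont_funs)
    fix W assume W: "luc_open \<Omega> W \<and> restrict h \<Omega> \<in> W"
    then obtain L \<epsilon> where L: "compact L" "L \<subseteq> \<Omega>" "0 < \<epsilon>"
      "{k \<in> cont_funs \<Omega>. \<forall>z\<in>L. \<bar>k z - restrict h \<Omega> z\<bar> < \<epsilon>} \<subseteq> W"
      unfolding luc_open_def by meson
    have "\<forall>\<^sub>F n in F. \<forall>z\<in>L. \<bar>g n z - h z\<bar> < \<epsilon>"
      using unif[OF L(1-3)] .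
    then show "\<forall>\<^sub>F n in F. restrict (g n) \<Omega> \<in> W"
    proof eventually_elim
      case (elim n)
      have "\<forall>z\<in>L. \<bar>restrict (g n) \<Omega> z - restrict h \<Omega> z\<bar> < \<epsilon>"
        using elim L(2) by (simp add: subset_iff)
      then show ?case
        using L(4) restrict_in_cont_funs[OF cont(1)[of n]] by blast
    qed
  qed
  then have "limitin (quotient_topology \<Omega>) (const_class \<Omega> \<circ> (\<lambda>n. restrict (g n) \<Omega>))
      (const_class \<Omega> (restrict h \<Omega>)) F"
    by (rule continuous_map_limit[OF quotient_imp_continuous_map[OF quotient_map_const_class]])
  then show ?thesis
    by (simp add: o_def const_class_restrict)
qed

context inner_metric
begin

lemma funpow_in_domain:
  assumes "f ` \<Omega> \<subseteq> \<Omega>" "z \<in> \<Omega>"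
  shows "(f ^^ n) z \<in> \<Omega>"
  using assms by (induction n) auto

lemma funpow_nonexpansive:
  assumes "f ` \<Omega> \<subseteq> \<Omega>" "\<forall>z\<in>\<Omega>. \<forall>w\<in>\<Omega>. d (f z) (f w) \<le> d z w" "z \<in> \<Omega>" "w \<in> \<Omega>"
  shows "d ((f ^^ n) z) ((f ^^ n) w) \<le> d z w"
proof (induction n)
  case (Suc n)
  have "d ((f ^^ Suc n) z) ((f ^^ Suc n) w) \<le> d ((f ^^ n) z) ((f ^^ n) w)"
    using assms(2) funpow_in_domain[OF assms(1)] assms(3,4) by simp
  then show ?case
    using Suc.IH by linarith
qed simp

text \<open>The Arzela-Ascoli argument: the normalised distance functions are 1-Lipschitz and bounded at \<open>z\<close> by
  \<open>d p z\<close>, so a diagonal subsequence converges on a countable dense set, hence everywhere, and the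
  convergence is uniform on totally bounded sets.\<close>

lemma horofunction_subsequence:
  assumes "open \<Omega>" and u: "\<And>n. u n \<in> \<Omega>" and p: "p \<in> \<Omega>"
  shows "\<exists>(r :: nat \<Rightarrow> nat) h. strict_mono r \<and> h p = 0 \<and>
    (\<forall>z\<in>\<Omega>. \<forall>w\<in>\<Omega>. \<bar>h z - h w\<bar> \<le> d z w) \<and>
    (\<forall>L \<epsilon>. compact L \<and> L \<subseteq> \<Omega> \<and> \<epsilon> > 0 \<longrightarrow>
      (\<forall>\<^sub>F n in sequentially. \<forall>z\<in>L. \<bar>d (u (r n)) z - d (u (r n)) p - h z\<bar> < \<epsilon>))"
proof -
  define g where "g n z = d (u n) z - d (u n) p" for n z
  have lip: "\<bar>g n z - g n w\<bar> \<le> d z w" if "z \<in> \<Omega>" "w \<in> \<Omega>" for n z w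
    using abs_dist_diff_le[OF u that] unfolding g_def by simp
  have gp: "g n p = 0" for n
    unfolding g_def by simp
  obtain D :: "'x set" where D: "countable D" "\<And>X. \<lbrakk>open X; X \<noteq> {}\<rbrakk> \<Longrightarrow> \<exists>x\<in>D. x \<in> X"
    using countable_dense_exists by blast
  define S where "S = D \<inter> \<Omega>"
  have S_near: "\<exists>x\<in>S. d z x < e" if ze: "z \<in> \<Omega>" "e > 0" for z e
  proof -
    obtain U where U: "open U" "z \<in> U" "U \<inter> \<Omega> = mball z e"
      using open_around_in_mball[OF ze] .
    have "open (U \<inter> \<Omega>)"
      using U(1) assms(1) by (rule open_Int)
    then obtain x where "x \<in> D" "x \<in> U \<inter> \<Omega>"
      using D(2)[of "U \<inter> \<Omega>"] U(2) ze(1) by blast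
    then show ?thesis
      using U(3) unfolding S_def by (intro bexI[of _ x]) auto
  qed
  have "countable S"
    using D(1) unfolding S_def by simp
  \<comment> \<open>the diagonal lemma asks for one bound at all points, hence the division by \<open>1 + d p x\<close>\<close>
  moreover have "norm (g n x / (1 + d p x)) \<le> 1" if "x \<in> S" for n x
  proof -
    have "\<bar>g n x\<bar> \<le> d p x"
      using lip[of p x n] p that gp unfolding S_def by simp
    moreover have "0 < 1 + d p x"
      using nonneg[of p x] by linarith
    ultimately show ?thesis
      by (simp add: abs_of_pos)
  qed
  ultimately obtain r :: "nat \<Rightarrow> nat" where r: "strict_mono r"
    "\<And>x. x \<in> S \<Longrightarrow> \<exists>l. (\<lambda>n. g (r n) x / (1 + d p x)) \<longlonglongrightarrow> l"
    using function_convergent_subsequence[of S "\<lambda>n x. g n x / (1 + d p x)" 1] by metis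
  have Cauchy_S: "Cauchy (\<lambda>n. g (r n) x)" if x: "x \<in> S" for x
  proof -
    obtain l where "(\<lambda>n. g (r n) x / (1 + d p x)) \<longlonglongrightarrow> l"
      using r(2)[OF x] by blast
    then have "(\<lambda>n. g (r n) x / (1 + d p x) * (1 + d p x)) \<longlonglongrightarrow> l * (1 + d p x)"
      by (intro tendsto_intros)
    moreover have "1 + d p x \<noteq> 0"
      using nonneg[of p x] by linarith
    ultimately have "(\<lambda>n. g (r n) x) \<longlonglongrightarrow> l * (1 + d p x)"
      by simp
    then show ?thesis
      by (rule LIMSEQ_imp_Cauchy)
  qed
  have "convergent (\<lambda>n. g (r n) z)" if z: "z \<in> \<Omega>" for z
  proof -
    have "Cauchy (\<lambda>n. g (r n) z)"
    proof (rule metric_CauchyI)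
      fix e :: real assume "e > 0"
      then obtain x where x: "x \<in> S" "d z x < e / 3"
        using S_near[OF z, of "e / 3"] by auto
      then have "x \<in> \<Omega>"
        unfolding S_def by simp
      obtain M where M: "\<And>m n. \<lbrakk>m \<ge> M; n \<ge> M\<rbrakk> \<Longrightarrow> dist (g (r m) x) (g (r n) x) < e / 3"
        using metric_CauchyD[OF Cauchy_S[OF x(1)], of "e / 3"] \<open>e > 0\<close> by auto
      have "dist (g (r m) z) (g (r n) z) < e" if "m \<ge> M" "n \<ge> M" for m n
        using M[OF that] lip[OF z \<open>x \<in> \<Omega>\<close>, of "r m"] lip[OF z \<open>x \<in> \<Omega>\<close>, of "r n"] x(2)
        unfolding dist_real_def by linarith
      then show "\<exists>M. \<forall>m\<ge>M. \<forall>n\<ge>M. dist (g (r m) z) (g (r n) z) < e"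
        by blast
    qed
    then show ?thesis
      by (rule Cauchy_convergent)
  qed
  then have lim: "(\<lambda>n. g (r n) z) \<longlonglongrightarrow> lim (\<lambda>n. g (r n) z)" if "z \<in> \<Omega>" for z
    using that by (simp add: convergent_LIMSEQ_iff)
  define h where "h z = lim (\<lambda>n. g (r n) z)" for z
  have h: "(\<lambda>n. g (r n) z) \<longlonglongrightarrow> h z" if "z \<in> \<Omega>" for z
    using lim[OF that] unfolding h_def .
  have lip_h: "\<bar>h z - h w\<bar> \<le> d z w" if "z \<in> \<Omega>" "w \<in> \<Omega>" for z w
  proof (rule tendsto_upperbound)
    show "(\<lambda>n. \<bar>g (r n) z - g (r n) w\<bar>) \<longlonglongrightarrow> \<bar>h z - h w\<bar>"
      using h that by (intro tendsto_intros)
  qed (use lip that in auto)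
  show ?thesis
  proof (intro exI[of _ r] exI[of _ h] conjI ballI allI impI)
    show "strict_mono r"
      by (rule r(1))
    show "h p = 0"
      using h[OF p] unfolding gp by (simp add: LIMSEQ_const_iff)
    show "\<bar>h z - h w\<bar> \<le> d z w" if "z \<in> \<Omega>" "w \<in> \<Omega>" for z w
      using lip_h[OF that] .
    show "\<forall>\<^sub>F n in sequentially. \<forall>z\<in>L. \<bar>d (u (r n)) z - d (u (r n)) p - h z\<bar> < \<epsilon>"
      if "compact L \<and> L \<subseteq> \<Omega> \<and> \<epsilon> > 0" for L \<epsilon>
    proof -
      have L: "compact L" "L \<subseteq> \<Omega>" "\<epsilon> > 0"
        using that by auto
      then have "compactin mtopology L"
        unfolding mtopology_eq by (simp add: compactin_subtopology)
      then have "mtotally_bounded L"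
        by (rule compactin_imp_mtotally_bounded)
      then obtain X where X: "finite X" "X \<subseteq> L" "L \<subseteq> (\<Union>x\<in>X. mball x (\<epsilon> / 3))"
        using L(3) unfolding mtotally_bounded_def by (metis divide_pos_pos zero_less_numeral)
      have "\<forall>\<^sub>F n in sequentially. dist (g (r n) x) (h x) < \<epsilon> / 3" if "x \<in> X" for x
        using h[of x] that X(2) L(2,3) by (intro tendstoD) auto
      then have "\<forall>\<^sub>F n in sequentially. \<forall>x\<in>X. dist (g (r n) x) (h x) < \<epsilon> / 3"
        using X(1) by (simp add: eventually_ball_finite_distrib)
      then show ?thesis
      proof eventually_elim
        case (elim n)
        show ?case
        proof
          fix z assume "z \<in> L"
          then obtain x where x: "x \<in> X" "z \<in> mball x (\<epsilon> / 3)"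
            using X(3) by blast
          then have xz: "x \<in> \<Omega>" "z \<in> \<Omega>" "d x z < \<epsilon> / 3"
            by auto
          have "dist (g (r n) x) (h x) < \<epsilon> / 3"
            using elim x(1) by blast
          then have "\<bar>g (r n) z - h z\<bar> < \<epsilon>"
            using lip[OF xz(1,2), of "r n"] lip_h[OF xz(1,2)] xz(3) unfolding dist_real_def by linarith
          then show "\<bar>d (u (r n)) z - d (u (r n)) p - h z\<bar> < \<epsilon>"
            unfolding g_def .
        qed
      qed
    qed
  qed
qed

text \<open>If \<open>h\<close> were such a distance function, it would exceed its value at \<open>q\<close> by 1 on the whole unit sphere
  around \<open>q\<close>.  But the distance from a far point \<open>u n\<close> drops by at least 1/2 between \<open>q\<close> and the
  point of that sphere passed on the way to \<open>u n\<close>, and the convergence to \<open>h\<close> is uniform on the compact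
  unit ball.\<close>

lemma horofunction_not_distance:
  assumes mcomplete and p: "p \<in> \<Omega>" and q: "q \<in> \<Omega>" and u: "\<And>n. u n \<in> \<Omega>"
    and esc: "filterlim (\<lambda>n. d p (u n)) at_top sequentially"
    and unif: "\<And>L \<epsilon>. \<lbrakk>compact L; L \<subseteq> \<Omega>; \<epsilon> > 0\<rbrakk> \<Longrightarrow>
      \<forall>\<^sub>F n in sequentially. \<forall>z\<in>L. \<bar>d (u n) z - d (u n) p - h z\<bar> < \<epsilon>"
  shows "\<not> (\<forall>z\<in>\<Omega>. h z = d q z + c)"
proof
  assume h: "\<forall>z\<in>\<Omega>. h z = d q z + c"
  have "\<forall>\<^sub>F n in sequentially. \<forall>z\<in>mcball q 1. \<bar>d (u n) z - d (u n) p - h z\<bar> < 1 / 4"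
    using hopf_rinow[OF assms(1) q] by (intro unif) auto
  moreover have "\<forall>\<^sub>F n in sequentially. d p q + 1 \<le> d p (u n)"
    using esc by (simp add: filterlim_at_top)
  ultimately have "\<forall>\<^sub>F n in sequentially. (\<forall>z\<in>mcball q 1. \<bar>d (u n) z - d (u n) p - h z\<bar> < 1 / 4) \<and>
      d p q + 1 \<le> d p (u n)"
    by eventually_elim blast
  then obtain n where n: "\<forall>z\<in>mcball q 1. \<bar>d (u n) z - d (u n) p - h z\<bar> < 1 / 4" "d p q + 1 \<le> d p (u n)"
    using eventually_happens' sequentially_bot by blast
  have "1 \<le> d q (u n)"
    using triangle[OF p q u[of n]] n(2) by linarith
  then obtain w where w: "w \<in> \<Omega>" "d q w = 1" "d w (u n) < d q (u n) - 1 + 1 / 2"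
    using point_at_distance[OF q u, of 1 n "1 / 2"] by auto
  have "\<bar>d (u n) w - d (u n) p - h w\<bar> < 1 / 4" "\<bar>d (u n) q - d (u n) p - h q\<bar> < 1 / 4"
    using n(1) w q by auto
  moreover have "h w = 1 + c" "h q = c"
    using h w q mdist_zero by auto
  ultimately show False
    using w(3) commute[of w "u n"] commute[of q "u n"] by linarith
qed

end

section \<open>Wolff's argument\<close>

context boundary_separating_metric
begin

text \<open>The sequence \<open>u\<close> consists of the last visits of the orbit of \<open>p\<close> to the balls of integer radius
  around \<open>p\<close>, thinned out to converge; the last conclusion records that the orbit is never closer
  to \<open>p\<close> afterwards.\<close>

theorem wolff_sequence:
  assumes p: "p \<in> \<Omega>" and f: "f ` \<Omega> \<subseteq> \<Omega>"
    and nonexp: "\<forall>z\<in>\<Omega>. \<forall>w\<in>\<Omega>. d (f z) (f w) \<le> d z w"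
    and div: "compactly_divergent \<Omega> (\<lambda>n. f ^^ n)"
  shows "\<exists>x\<in>end_boundary \<Omega> K. \<exists>u h. range u \<subseteq> \<Omega> \<and> h p = 0 \<and> continuous_on \<Omega> h \<and>
    (\<forall>z\<in>\<Omega>. (\<lambda>k. d z (u k) - d p (u k)) \<longlonglongrightarrow> h z) \<and>
    limitin (quotient_topology \<Omega>) (\<lambda>k. const_class \<Omega> (d (u k))) (const_class \<Omega> h) sequentially \<and>
    const_class \<Omega> h \<notin> (\<lambda>q. const_class \<Omega> (d q)) ` \<Omega> \<and>
    (\<forall>n. limitin (end_topology \<Omega> K) (Inl \<circ> (\<lambda>k. (f ^^ n) (u k))) x sequentially) \<and>
    (\<forall>n k. d p (u k) \<le> d p ((f ^^ n) (u k)))"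
proof -
  note fn = funpow_in_domain[OF f]
  note nonexpn = funpow_nonexpansive[OF f nonexp]
  define D where "D n = d p ((f ^^ n) p)" for n
  have D: "filterlim D at_top sequentially"
    unfolding filterlim_at_top
  proof
    fix R
    have "compact {p}" "{p} \<subseteq> \<Omega>" "compact (mcball p R)" "mcball p R \<subseteq> \<Omega>"
      using p hopf_rinow[OF complete p] by auto
    then obtain n0 where "\<forall>n\<ge>n0. (f ^^ n) ` {p} \<inter> mcball p R = {}"
      using div unfolding compactly_divergent_def by meson
    then have "R \<le> D n" if "n \<ge> n0" for n
      using that p fn[OF p, of n] unfolding D_def by force
    then show "\<forall>\<^sub>F n in sequentially. R \<le> D n"
      unfolding eventually_sequentially by blast
  qed
  \<comment> \<open>a maximum over a nonempty set, as \<open>D 0 = 0\<close>\<close>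
  define N where "N k = Max {n. D n \<le> real k}" for k
  have fin: "finite {n. D n \<le> real k}" for k
  proof -
    have "\<forall>\<^sub>F n in sequentially. real k + 1 \<le> D n"
      using D by (simp add: filterlim_at_top)
    then have "\<forall>\<^sub>F n in sequentially. \<not> D n \<le> real k"
      by eventually_elim simp
    then show ?thesis
      by (simp add: eventually_cofinite flip: cofinite_eq_sequentially)
  qed
  have "D 0 = 0"
    unfolding D_def using mdist_zero[OF p] by simp
  then have ne: "0 \<in> {n. D n \<le> real k}" for k
    by simp
  have N_le: "D (N k) \<le> D (N k + n)" for k n
  proof (cases "n = 0")
    case False
    have "D (N k) \<le> real k"
      using Max_in[OF fin, of k] ne[of k] unfolding N_def by blast
    moreover have "\<not> D (N k + n) \<le> real k"
      using Max_ge[OF fin, of "N k + n" k] False unfolding N_def by auto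
    ultimately show ?thesis
      by simp
  qed simp
  have N_lim: "filterlim N at_top sequentially"
    unfolding filterlim_at_top
  proof
    fix n
    have "n \<le> N k" if "k \<ge> nat \<lceil>D n\<rceil>" for k
    proof -
      have "D n \<le> real k"
        using that by linarith
      then show ?thesis
        unfolding N_def using Max_ge[OF fin, of n k] by simp
    qed
    then show "\<forall>\<^sub>F k in sequentially. n \<le> N k"
      unfolding eventually_sequentially by blast
  qed
  define v where "v k = (f ^^ N k) p" for k
  have v: "v k \<in> \<Omega>" for k
    unfolding v_def using fn[OF p] .
  have esc_v: "filterlim (\<lambda>k. d p (v k)) at_top sequentially"
    using filterlim_compose[OF D N_lim] unfolding v_def D_def .
  have iter: "(f ^^ n) (v k) = (f ^^ (N k + n)) p" for n k
    unfolding v_def add.commute[of "N k" n] by (simp only: funpow_add o_apply)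
  then have iter': "(f ^^ n) (v k) = (f ^^ N k) ((f ^^ n) p)" for n k
    by (simp only: funpow_add o_apply)
  have v_record: "d p (v k) \<le> d p ((f ^^ n) (v k))" for n k
    using N_le[of k n] unfolding D_def iter unfolding v_def .
  have v_step: "d (v k) ((f ^^ n) (v k)) \<le> d p ((f ^^ n) p)" for n k
    using nonexpn[OF p fn[OF p], of "N k" n] unfolding iter' by (simp only: v_def)
  have "range v \<subseteq> closure \<Omega>"
    using v closure_subset by blast
  then obtain x and s :: "nat \<Rightarrow> nat" where s: "strict_mono s"
    "limitin (end_topology \<Omega> K) (Inl \<circ> (v \<circ> s)) x sequentially"
    by (rule convergent_subsequence)
  obtain r :: "nat \<Rightarrow> nat" and h where r: "strict_mono r" and h: "h p = 0"
    "\<forall>z\<in>\<Omega>. \<forall>w\<in>\<Omega>. \<bar>h z - h w\<bar> \<le> d z w"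
    and unif: "\<forall>L \<epsilon>. compact L \<and> L \<subseteq> \<Omega> \<and> \<epsilon> > 0 \<longrightarrow>
      (\<forall>\<^sub>F n in sequentially. \<forall>z\<in>L. \<bar>d (v (s (r n))) z - d (v (s (r n))) p - h z\<bar> < \<epsilon>)"
    using horofunction_subsequence[OF open_domain, of "\<lambda>n. v (s n)", OF v p] by (elim exE conjE) (rule that)
  define u where "u n = v (s (r n))" for n
  have u: "u n \<in> \<Omega>" for n
    unfolding u_def by (rule v)
  have unif_u: "\<forall>\<^sub>F n in sequentially. \<forall>z\<in>L. \<bar>d (u n) z - d (u n) p - h z\<bar> < \<epsilon>"
    if "compact L" "L \<subseteq> \<Omega>" "\<epsilon> > 0" for L \<epsilon>
    using unif that unfolding u_def by blast
  have sr: "strict_mono (s \<circ> r)"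
    using s(1) r by (rule strict_mono_o)
  have esc: "filterlim (\<lambda>k. d p (u k)) at_top sequentially"
    using filterlim_compose[OF esc_v filterlim_subseq[OF sr]] by (simp add: u_def)
  have lim_u: "limitin (end_topology \<Omega> K) (Inl \<circ> u) x sequentially"
    using limitin_subsequence[OF r s(2)] by (simp add: u_def[abs_def] o_def)
  have cont_h: "continuous_on \<Omega> h"
    using h(2) by (intro lipschitz_imp_continuous_on) blast
  show ?thesis
  proof (intro bexI[of _ x] exI[of _ u] exI[of _ h] conjI ballI allI)
    show "x \<in> end_boundary \<Omega> K"
    proof -
      have "q \<notin> \<Omega>" if "x = Inl q" for q
        using escaping_limit_not_in_domain[OF esc p u] limit_Inl_tendsto lim_u unfolding that by blast
      then show ?thesis
        using limitin_topspace[OF lim_u] by (auto simp: topspace_end_topology end_boundary_def)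
    qed
    show "range u \<subseteq> \<Omega>"
      using u by blast
    show "(\<lambda>k. d z (u k) - d p (u k)) \<longlonglongrightarrow> h z" if z: "z \<in> \<Omega>" for z
    proof (rule tendstoI)
      fix e :: real assume "e > 0"
      then have "\<forall>\<^sub>F k in sequentially. \<forall>z\<in>{z}. \<bar>d (u k) z - d (u k) p - h z\<bar> < e"
        using z by (intro unif_u) auto
      then show "\<forall>\<^sub>F k in sequentially. dist (d z (u k) - d p (u k)) (h z) < e"
        by eventually_elim (simp add: dist_real_def commute[of _ "u _"])
    qed
    have "limitin (quotient_topology \<Omega>) (\<lambda>k. const_class \<Omega> (\<lambda>z. d (u k) z - d (u k) p)) (const_class \<Omega> h) sequentially"
      using u unif_u cont_h by (intro limitin_const_class continuous_intros continuous_on_dist) auto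
    moreover have "const_class \<Omega> (\<lambda>z. d (u k) z - d (u k) p) = const_class \<Omega> (d (u k))" for k
      by (rule const_class_shift[where c = "- d (u k) p"]) simp
    ultimately show "limitin (quotient_topology \<Omega>) (\<lambda>k. const_class \<Omega> (d (u k))) (const_class \<Omega> h) sequentially"
      by simp
    show "const_class \<Omega> h \<notin> (\<lambda>q. const_class \<Omega> (d q)) ` \<Omega>"
    proof
      assume "const_class \<Omega> h \<in> (\<lambda>q. const_class \<Omega> (d q)) ` \<Omega>"
      then obtain q where q: "q \<in> \<Omega>" "const_class \<Omega> h = const_class \<Omega> (d q)"
        by blast
      show False
        using const_class_eqD[OF cont_h q(2)] horofunction_not_distance[OF complete p q(1) u esc unif_u]
        by blast
    qed
    have "d (u k) ((f ^^ n) (u k)) \<le> d p ((f ^^ n) p)" for n k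
      unfolding u_def by (rule v_step)
    then show "limitin (end_topology \<Omega> K) (Inl \<circ> (\<lambda>k. (f ^^ n) (u k))) x sequentially" for n
      using lim_u by (intro bounded_distance_same_limit[OF esc p u fn[OF u]])
    show "d p (u k) \<le> d p ((f ^^ n) (u k))" for n k
      unfolding u_def by (rule v_record)
  qed (use h cont_h in auto)
qed

end

text \<open>Bounds holding near \<open>x\<close> inside \<open>\<Omega>\<close> hold along sequences tending to \<open>x\<close>, which never take the value
  \<open>x\<close> excluded by the punctured filter because \<open>x\<close> lies outside \<open>\<Omega>\<close>.\<close>

lemma toward_end_sequence:
  assumes lim: "limitin (end_topology \<Omega> K) (Inl \<circ> s) x sequentially" and "range s \<subseteq> \<Omega>" "x \<in> end_boundary \<Omega> K"
  shows "filterlim s (toward_end \<Omega> K x) sequentially"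
  unfolding filterlim_iff
proof (intro allI impI)
  fix P assume "eventually P (toward_end \<Omega> K x)"
  then obtain Q where Q: "eventually Q (atin_within (end_topology \<Omega> K) x (Inl ` \<Omega>))" "\<And>w. Q (Inl w) \<Longrightarrow> P w"
    unfolding toward_end_def eventually_filtercomap by blast
  obtain T where T: "openin (end_topology \<Omega> K) T" "x \<in> T" "\<forall>y\<in>T. y \<in> Inl ` \<Omega> \<and> y \<noteq> x \<longrightarrow> Q y"
    using Q(1) limitin_topspace[OF lim] unfolding eventually_atin_within by blast
  have "\<forall>\<^sub>F n in sequentially. (Inl \<circ> s) n \<in> T"
    using limitinD[OF lim T(1,2)] .
  then show "\<forall>\<^sub>F n in sequentially. P (s n)"
  proof eventually_elim
    case (elim n)
    have "Inl (s n) \<noteq> x" "Inl (s n) \<in> Inl ` \<Omega>"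
      using assms(2,3) unfolding end_boundary_def by auto
    then show ?case
      using elim T(3) Q(2) by auto
  qed
qed

theorem theorem1p5:
  fixes A :: "('x::{t2_space, second_countable_topology}, 'n::finite) atlas"
    and \<Omega> :: "'x set" and K :: "nat \<Rightarrow> 'x set" and p :: 'x and f :: "'x \<Rightarrow> 'x"
  assumes "complex_manifold A"
    and "open \<Omega>" "connected \<Omega>" "\<Omega> \<noteq> {}" "\<Omega> \<noteq> UNIV"
    and "complete_kobayashi_hyperbolic A \<Omega>"
    and "compact_exhaustion (closure \<Omega>) K"
    and "sequentially_compact_space (end_topology \<Omega> K)"
    and "\<forall>x\<in>frontier \<Omega>. \<forall>y\<in>frontier \<Omega>. x \<noteq> y \<longrightarrow>
           filterlim (\<lambda>(z, w). kobayashi A \<Omega> z w) at_top (at (x, y) within \<Omega> \<times> \<Omega>)"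
    and "p \<in> \<Omega>"
    and "holomorphic_self_map A \<Omega> f"
    and "compactly_divergent \<Omega> (\<lambda>n. f ^^ n)"
  shows "\<exists>x\<in>end_boundary \<Omega> K. \<exists>\<xi>\<in>horofunctions_at A \<Omega> K x.
           (\<forall>n. \<forall>R>0. (f ^^ n) ` horosphere \<Omega> p \<xi> R \<subseteq> big_horosphere A \<Omega> K p x R) \<and>
           (\<forall>n. \<forall>R>0. (f ^^ n) ` small_horosphere A \<Omega> K p x R \<subseteq> big_horosphere A \<Omega> K p x R)"
proof -
  let ?k = "kobayashi A \<Omega>"
  have "inner_metric \<Omega> ?k"
    using assms(1-3,6) kobayashi_inner_metric unfolding complete_kobayashi_hyperbolic_def by blast
  then interpret inner_metric \<Omega> ?k .
  interpret boundary_separating_metric \<Omega> ?k K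
  proof
    show "mcomplete"
      using assms(6) unfolding complete_kobayashi_hyperbolic_def by blast
    show "filterlim (\<lambda>(z, w). ?k z w) at_top (at (x, y) within \<Omega> \<times> \<Omega>)"
      if "x \<in> frontier \<Omega>" "y \<in> frontier \<Omega>" "x \<noteq> y" for x y
      using assms(9) that by blast
  qed (use assms in auto)
  have f: "f ` \<Omega> \<subseteq> \<Omega>"
    using assms(11) unfolding holomorphic_self_map_def by blast
  have nonexp: "\<forall>z\<in>\<Omega>. \<forall>w\<in>\<Omega>. ?k (f z) (f w) \<le> ?k z w"
    using kobayashi_self_map_le[OF assms(1-3,11)] by blast
  note fn = funpow_in_domain[OF f]
  note nonexpn = funpow_nonexpansive[OF f nonexp]
  obtain x u h where x: "x \<in> end_boundary \<Omega> K" and u: "range u \<subseteq> \<Omega>"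
    and h: "h p = 0" "continuous_on \<Omega> h" and h_lim: "\<forall>z\<in>\<Omega>. (\<lambda>k. ?k z (u k) - ?k p (u k)) \<longlonglongrightarrow> h z"
    and class_lim: "limitin (quotient_topology \<Omega>) (\<lambda>k. const_class \<Omega> (?k (u k))) (const_class \<Omega> h) sequentially"
    and not_point: "const_class \<Omega> h \<notin> (\<lambda>q. const_class \<Omega> (?k q)) ` \<Omega>"
    and lim: "\<forall>n. limitin (end_topology \<Omega> K) (Inl \<circ> (\<lambda>k. (f ^^ n) (u k))) x sequentially"
    and farther: "\<forall>n k. ?k p (u k) \<le> ?k p ((f ^^ n) (u k))"
    using wolff_sequence[OF assms(10) f nonexp assms(12)] by (elim bexE exE conjE) (rule that)
  define \<xi> where "\<xi> = const_class \<Omega> h"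
  have lim\<xi>: "limitin (quotient_topology \<Omega>) (kobayashi_embed A \<Omega> \<circ> u) \<xi> sequentially"
    using class_lim unfolding \<xi>_def kobayashi_embed_def by (simp add: o_def)
  have "\<xi> \<in> metric_compactification A \<Omega>"
    unfolding metric_compactification_def in_closure_of
  proof (intro conjI allI impI)
    show "\<xi> \<in> topspace (quotient_topology \<Omega>)"
      using lim\<xi> by (rule limitin_topspace)
    fix T assume T: "\<xi> \<in> T \<and> openin (quotient_topology \<Omega>) T"
    then have "\<forall>\<^sub>F k in sequentially. (kobayashi_embed A \<Omega> \<circ> u) k \<in> T"
      using limitinD[OF lim\<xi>] by blast
    then obtain k where "(kobayashi_embed A \<Omega> \<circ> u) k \<in> T"
      using eventually_happens' sequentially_bot by blast
    then show "\<exists>y. y \<in> kobayashi_embed A \<Omega> ` \<Omega> \<and> y \<in> T"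
      using u by auto
  qed
  moreover have "\<xi> \<notin> kobayashi_embed A \<Omega> ` \<Omega>"
    using not_point unfolding \<xi>_def kobayashi_embed_def .
  moreover have "limitin (end_topology \<Omega> K) (Inl \<circ> u) x sequentially"
    using spec[OF lim, of 0] by simp
  ultimately have \<xi>: "\<xi> \<in> horofunctions_at A \<Omega> K x"
    unfolding horofunctions_at_def metric_boundary_def using u lim\<xi> by blast
  have toward: "filterlim (\<lambda>k. (f ^^ n) (u k)) (toward_end \<Omega> K x) sequentially" for n
    using spec[OF lim, of n] x u fn by (intro toward_end_sequence) auto
  have horo: "horofunction p \<xi> z = h z" if "z \<in> \<Omega>" for z
    using horofunction_const_class[OF h(2) assms(10) h(1)] that unfolding \<xi>_def by simp
  have big: "(f ^^ n) ` horosphere \<Omega> p \<xi> R \<subseteq> big_horosphere A \<Omega> K p x R" for n R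
  proof (rule image_subsetI)
    fix z assume "z \<in> horosphere \<Omega> p \<xi> R"
    then have z: "z \<in> \<Omega>" "h z < 1/2 * ln R"
      using horo unfolding horosphere_def by auto
    \<comment> \<open>a value strictly in between: lower limits preserve only weak inequalities\<close>
    then obtain c where c: "h z < c" "c < 1/2 * ln R"
      using dense by blast
    let ?F = "\<lambda>w. ereal (?k ((f ^^ n) z) w - ?k p w)"
    have "\<forall>\<^sub>F k in sequentially. ?k z (u k) - ?k p (u k) < c"
      using order_tendstoD(2)[OF h_lim[rule_format, OF z(1)] c(1)] .
    then have less: "\<forall>\<^sub>F k in sequentially. ?F ((f ^^ n) (u k)) < ereal c"
    proof eventually_elim
      case (elim j)
      have "?k ((f ^^ n) z) ((f ^^ n) (u j)) \<le> ?k z (u j)"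
        using z(1) u by (intro nonexpn) auto
      then show ?case
        using elim spec[OF spec[OF farther, of n], of j] by simp
    qed
    have "Liminf (toward_end \<Omega> K x) ?F \<le> ereal c"
    proof (rule ccontr)
      assume "\<not> ?thesis"
      then have "\<forall>\<^sub>F w in toward_end \<Omega> K x. ereal c < ?F w"
        by (intro less_LiminfD) simp
      then have "\<forall>\<^sub>F k in sequentially. ereal c < ?F ((f ^^ n) (u k))"
        using toward[of n] unfolding filterlim_iff by blast
      with less have "\<forall>\<^sub>F k :: nat in sequentially. False"
        by eventually_elim simp
      then show False
        by simp
    qed
    also have "ereal c < ereal (1/2 * ln R)"
      using c(2) by simp
    finally show "(f ^^ n) z \<in> big_horosphere A \<Omega> K p x R"
      unfolding big_horosphere_def using fn[OF z(1)] by simp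
  qed
  have small: "small_horosphere A \<Omega> K p x R \<subseteq> horosphere \<Omega> p \<xi> R" for R
  proof
    fix z assume "z \<in> small_horosphere A \<Omega> K p x R"
    then have z: "z \<in> \<Omega>" "Limsup (toward_end \<Omega> K x) (\<lambda>w. ereal (?k z w - ?k p w)) < ereal (1/2 * ln R)"
      unfolding small_horosphere_def by auto
    obtain c where c: "Limsup (toward_end \<Omega> K x) (\<lambda>w. ereal (?k z w - ?k p w)) < ereal c" "ereal c < ereal (1/2 * ln R)"
      using ereal_dense2[OF z(2)] by blast
    have "\<forall>\<^sub>F w in toward_end \<Omega> K x. ereal (?k z w - ?k p w) < ereal c"
      using Limsup_lessD[OF c(1)] .
    then have "\<forall>\<^sub>F k in sequentially. ereal (?k z (u k) - ?k p (u k)) < ereal c"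
      using toward[of 0] unfolding filterlim_iff funpow_0 by blast
    then have "\<forall>\<^sub>F k in sequentially. ?k z (u k) - ?k p (u k) \<le> c"
      by eventually_elim simp
    then have "h z \<le> c"
      by (intro tendsto_upperbound[OF h_lim[rule_format, OF z(1)]]) auto
    then show "z \<in> horosphere \<Omega> p \<xi> R"
      unfolding horosphere_def using z(1) c(2) horo by simp
  qed
  show ?thesis
    using x \<xi> big small by (intro bexI[of _ x] bexI[of _ \<xi>] conjI allI impI) blast+
qed

end
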